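(* Let $M$, $N\ge1$ and $Q\ge 1$ be real numbers and let $(u_n)_{M<n\le M+N}$ be a sequence of non-negative real numbers having support on a consistent multiplicative sequence $(\mathcal{K}_q)_{q\le Q}$ that satisfies the Johnsen-Gallagher condition. For any real parameter $V$ with $0<V\le N/2$, we have $$\frac{1-2V/N}{N}\Bigl|\sum_{M<n\le M+N}u_n\Bigr|^2\le\int_{-\infty}^\infty\Bigl|\sum_{\substack{M<n\le M+N\\ |n-t|\le V}}u_n\Bigr|^2\frac{dt}{4V^2}\le\frac{1}{2V\,L^*(Q,V)}\sum_{M<n\le M+N}u_n^2,$$ where $$L^*(Q,V)=\sum_{q\le Q}\frac{g(q)}{2V+q(q+Q)}.$$
   Context: For each positive integer $q\le Q$, $\mathcal{K}_q$ is a non-empty subset of $\mathbb{Z}/q\mathbb{Z}$ (so $\mathcal{K}_1=\mathbb{Z}/1\mathbb{Z}$ and $|\mathcal{K}_1|=1$). The sequence is multiplicative if, for $q=p_1^{e_1}\cdots p_r^{e_r}$ with distinct primes $p_i$, one has $\mathcal{K}_q=\prod_{i}\mathcal{K}_{p_i^{e_i}}$ under the Chinese remainder identification $\mathbb{Z}/q\mathbb{Z}\simeq\prod_i\mathbb{Z}/p_i^{e_i}\mathbb{Z}$. It is consistent if, whenever $d\mid q$, the image of $\mathcal{K}_q$ under reduction modulo $d$ is $\mathcal{K}_d$. It satisfies the Johnsen-Gallagher condition if for all $q\le Q$, all $d\mid q$ and all $y\in\mathcal{K}_d$, one has $\#\{x\in\mathcal{K}_q: x\equiv y \bmod d\}=|\mathcal{K}_q|/|\mathcal{K}_d|$.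 The sequence $(u_n)$ (indexed by integers $n\in(M,M+N]$) has support on $(\mathcal{K}_q)_{q\le Q}$ if, whenever $u_n\ne0$, the class of $n$ modulo $q$ belongs to $\mathcal{K}_q$ for every $q\le Q$. The function $g$ is $$g(q)=\prod_{p^\alpha\| q}\biggl(\frac{p^\alpha}{|\mathcal{K}_{p^\alpha}|}-\frac{p^{\alpha-1}}{|\mathcal{K}_{p^{\alpha-1}}|}\biggr),$$ where $p^\alpha\|q$ means that $p^\alpha$ is the exact power of the prime $p$ dividing $q$ with $\alpha\ge1$ (so $g(1)=1$). *)

theory Defs
  imports "HOL-Analysis.Analysis" "HOL-Number_Theory.Residues"
begin

text \<open>
  The ring of integers modulo \<open>q\<close> is \<open>residue_ring (int q)\<close>, whose carrier consists of the
  canonical representatives \<open>{0..int q - 1}\<close>; the class of an integer \<open>n\<close> is \<open>n mod int q\<close>, and the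
  reduction map onto the integers modulo a divisor \<open>d\<close> of \<open>q\<close> is \<open>\<lambda>x. x mod int d\<close>.
  A family \<open>(K q)\<close>, \<open>q \<le> Q\<close>, is modelled by a total function on \<^typ>\<open>nat\<close>; every notion below
  only looks at indices \<open>q\<close> with \<open>1 \<le> q \<le> Q\<close>.
\<close>

definition moduli :: "real \<Rightarrow> nat set" where
  "moduli Q = {q. 1 \<le> q \<and> real q \<le> Q}"

definition residue_sets :: "real \<Rightarrow> (nat \<Rightarrow> int set) \<Rightarrow> bool" where
  "residue_sets Q K \<longleftrightarrow>
     (\<forall>q\<in>moduli Q. K q \<noteq> {} \<and> K q \<subseteq> carrier (residue_ring (int q)))"

text \<open>
  The product of the sets \<open>K (p ^ e)\<close> over the prime powers exactly dividing \<open>q\<close>, read modulo \<open>q\<close>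
  through the Chinese remainder isomorphism \<open>x \<mapsto> (x mod p ^ e)\<close>. For \<open>q = 1\<close> the product is
  empty and \<open>K 1\<close> is the whole ring.
\<close>
definition multiplicative_sets :: "real \<Rightarrow> (nat \<Rightarrow> int set) \<Rightarrow> bool" where
  "multiplicative_sets Q K \<longleftrightarrow>
     (\<forall>q\<in>moduli Q. K q = {x \<in> carrier (residue_ring (int q)).
        \<forall>p\<in>prime_factors q. x mod int (p ^ multiplicity p q) \<in> K (p ^ multiplicity p q)})"

definition consistent_sets :: "real \<Rightarrow> (nat \<Rightarrow> int set) \<Rightarrow> bool" where
  "consistent_sets Q K \<longleftrightarrow>
     (\<forall>q\<in>moduli Q. \<forall>d. d dvd q \<longrightarrow> (\<lambda>x. x mod int d) ` K q = K d)"

definition johnsen_gallagher :: "real \<Rightarrow> (nat \<Rightarrow> int set) \<Rightarrow> bool" where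
  "johnsen_gallagher Q K \<longleftrightarrow>
     (\<forall>q\<in>moduli Q. \<forall>d. d dvd q \<longrightarrow> (\<forall>y\<in>K d.
        real (card {x \<in> K q. [x = y] (mod int d)}) = real (card (K q)) / real (card (K d))))"

definition index_range :: "real \<Rightarrow> real \<Rightarrow> int set" where
  "index_range M N = {n. M < of_int n \<and> of_int n \<le> M + N}"

definition supported_on ::
    "real \<Rightarrow> real \<Rightarrow> (int \<Rightarrow> real) \<Rightarrow> real \<Rightarrow> (nat \<Rightarrow> int set) \<Rightarrow> bool" where
  "supported_on M N u Q K \<longleftrightarrow>
     (\<forall>n\<in>index_range M N. u n \<noteq> 0 \<longrightarrow> (\<forall>q\<in>moduli Q. n mod int q \<in> K q))"

definition g_fun :: "(nat \<Rightarrow> int set) \<Rightarrow> nat \<Rightarrow> real" where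
  "g_fun K q = (\<Prod>p\<in>prime_factors q.
     real (p ^ multiplicity p q) / real (card (K (p ^ multiplicity p q)))
     - real (p ^ (multiplicity p q - 1)) / real (card (K (p ^ (multiplicity p q - 1)))))"

definition L_star :: "(nat \<Rightarrow> int set) \<Rightarrow> real \<Rightarrow> real \<Rightarrow> real" where
  "L_star K Q V = (\<Sum>q\<in>moduli Q. g_fun K q / (2 * V + real q * (real q + Q)))"

end

theory Submission
  imports Defs
begin

text \<open>
  Write \<open>l = 2 * V\<close> and \<open>S\<^sub>t(x)\<close> for the sum of \<open>u n * e(n x)\<close> over \<open>\<bar>n - t\<bar> \<le> V\<close>. The lower bound is the
  Cauchy-Schwarz inequality on the interval \<open>[M - V, M + N + V]\<close> outside which \<open>S\<^sub>t(0)\<close> vanishes.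

  For the upper bound, the normalised indicators of the sets \<open>K q\<close> have, by the Johnsen-Gallagher
  condition, Fourier coefficients depending only on the reduced frequency, and those of exact
  denominator \<open>q\<close> have total energy \<open>g q\<close>; Cauchy-Schwarz then bounds \<open>g q * S\<^sub>t(0)\<^sup>2\<close> by the sum of
  \<open>\<bar>S\<^sub>t(a/q)\<bar>\<^sup>2\<close> over reduced \<open>a/q\<close>. Integrating over \<open>t\<close> turns \<open>\<bar>S\<^sub>t(x)\<bar>\<^sup>2\<close> into a quadratic form with
  coefficients \<open>max 0 (l - \<bar>m - n\<bar>)\<close>, that is, into \<open>\<bar>\<Sum> u n * e(n y)\<bar>\<^sup>2\<close> averaged over \<open>y\<close> against a
  Fejer kernel \<open>F\<close> centred at \<open>x\<close>. It remains to see that the sum of \<open>F (a/q - y) / (l + q (q + Q))\<close> over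
  all reduced fractions is at most \<open>l\<close> for every \<open>y\<close>. The arcs of radius \<open>1 / (q (q + Q))\<close> around the
  fractions are disjoint, and each summand is dominated by the integral over its arc of
  \<open>min (l\<^sup>2/2) (1 / (8 x\<^sup>2))\<close>, a function of integral \<open>l\<close>.
\<close>

section \<open>Mass of disjoint arcs\<close>

text \<open>The intervals around the \<open>y i\<close> do not overlap, so the increments of a
  monotone function over them are parts of its increment from \<open>a\<close> to \<open>b\<close>.
  The induction removes the rightmost interval; \<open>b\<close> is generalised because the
  remaining ones end by \<open>y k - r k\<close>.\<close>

lemma sum_increments_le:
  fixes y r :: "'i \<Rightarrow> real" and H :: "real \<Rightarrow> real"
  assumes "finite I" and "mono H"
    and "\<And>i. i \<in> I \<Longrightarrow> 0 < r i"
    and "\<And>i j. i \<in> I \<Longrightarrow> j \<in> I \<Longrightarrow> i \<noteq> j \<Longrightarrow> r i + r j \<le> \<bar>y i - y j\<bar>"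
    and "a \<le> b" and "\<And>i. i \<in> I \<Longrightarrow> a \<le> y i - r i \<and> y i + r i \<le> b"
  shows "(\<Sum>i\<in>I. H (y i + r i) - H (y i - r i)) \<le> H b - H a"
  using assms
proof (induction "card I" arbitrary: I b)
  case 0
  then show ?case by (auto dest: monoD)
next
  case (Suc n)
  have ne: "I \<noteq> {}" using Suc.hyps(2) by auto
  obtain k where k: "k \<in> I" "\<And>i. i \<in> I \<Longrightarrow> y i \<le> y k"
    using Max_in[of "y ` I"] Max_ge[of "y ` I"] \<open>finite I\<close> ne
    by (metis (no_types, lifting) finite_imageI image_iff image_is_empty)
  have "(\<Sum>i\<in>I - {k}. H (y i + r i) - H (y i - r i)) \<le> H (y k - r k) - H a"
  proof (rule Suc.hyps(1))
    show "n = card (I - {k})" using Suc.hyps(2) k(1) Suc.prems(1) by simp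
    fix i assume i: "i \<in> I - {k}"
    have "r i + r k \<le> \<bar>y i - y k\<bar>" using Suc.prems(4) i k(1) by blast
    then show "a \<le> y i - r i \<and> y i + r i \<le> y k - r k"
      using k(2)[of i] Suc.prems(6)[of i] i by auto
  qed (use Suc.prems k in auto)
  moreover have "H (y k + r k) \<le> H b" using Suc.prems(2,6) k(1) by (blast dest: monoD)
  ultimately show ?case
    using sum.remove[OF \<open>finite I\<close> k(1), of "\<lambda>i. H (y i + r i) - H (y i - r i)"] by simp
qed

text \<open>The odd primitive of \<open>min (1/2) (1 / (8 * t\<^sup>2))\<close>, a function of total mass \<open>1\<close> whose double
  dominates the Fejer kernel in the normalisation where the latter has height \<open>1\<close>.\<close>

definition mass :: "real \<Rightarrow> real" where
  "mass t = (if \<bar>t\<bar> \<le> 1/2 then t / 2 else sgn t / 2 - 1 / (8 * t))"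

lemma mass_minus: "mass (- t) = - mass t"
  by (simp add: mass_def sgn_if)

lemma mass_middle: "- 1/2 \<le> t \<Longrightarrow> t \<le> 1/2 \<Longrightarrow> mass t = t / 2"
  by (auto simp: mass_def)

lemma mass_right: "1/2 \<le> t \<Longrightarrow> mass t = 1/2 - 1 / (8 * t)"
  by (cases "t = 1/2", hypsubst) (simp_all add: mass_def)

lemma mono_mass: "mono mass"
proof (rule monoI)
  fix s t :: real assume st: "s \<le> t"
  \<comment> \<open>On the non-negative half-line the value 1/4 at the breakpoint 1/2 separates the
    two branches; oddness then carries monotonicity over to negative arguments.\<close>
  have pos: "mass s \<le> mass t" if "0 \<le> s" "s \<le> t" for s t
  proof -
    have b: "1/4 \<le> mass t" if "t > 1/2" for t
      using that by (simp add: mass_right field_simps)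
    have c: "mass t \<le> 1/4" if "0 \<le> t" "t \<le> 1/2" for t
      using that by (simp add: mass_def)
    show ?thesis
    proof (cases "s > 1/2")
      case True
      then have "1 / (8 * t) \<le> 1 / (8 * s)" using that by (intro divide_left_mono) auto
      then show ?thesis using True that by (simp add: mass_right)
    next
      case False
      show ?thesis
      proof (cases "t > 1/2")
        case True
        then show ?thesis using b[of t] c[of s] False that by linarith
      qed (use False that in \<open>simp add: mass_middle\<close>)
    qed
  qed
  have nn: "0 \<le> mass t" if "0 \<le> t" for t
    using pos[of 0 t] that by (simp add: mass_def)
  show "mass s \<le> mass t"
  proof (cases "0 \<le> s")
    case True then show ?thesis using pos st by blast
  next
    case False
    then have "0 \<le> mass (- s)" using nn[of "-s"] by simp
    then show ?thesis
      using nn[of t] pos[of "-t" "-s"] st False mass_minus[of s] mass_minus[of t]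
      by (cases "0 \<le> t") auto
  qed
qed


text \<open>Twice the derivative of \<open>mass\<close>, that is, the minimum of 1 and
  \<open>1 / (4 * t\<^sup>2)\<close>.\<close>

definition envelope :: "real \<Rightarrow> real" where
  "envelope t = (if \<bar>t\<bar> \<le> 1/2 then 1 else 1 / (4 * t\<^sup>2))"

lemma recip_add_sub_cross:
  fixes a b :: real
  assumes "0 < a" "0 < b"
  shows "1 / (8 * a) + 1 / (8 * b) = (a + b) / 2 / (4 * (a * b))"
    and "1 / (8 * a) - 1 / (8 * b) = (b - a) / 2 / (4 * (a * b))"
  using assms by (simp_all add: field_simps)

text \<open>For small \<open>r\<close> the increment is about \<open>r * envelope X\<close>; for
  large \<open>r\<close> it saturates at the total mass 1, which the factor
  \<open>1 / (1 + r)\<close> accommodates. The cases record on which branches the points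
  \<open>X - r\<close>, \<open>X\<close> and \<open>X + r\<close> lie.\<close>

lemma mass_increment_ge_nonneg:
  assumes X: "0 \<le> X" and r: "0 < r"
  shows "r / (1 + r) * envelope X \<le> mass (X + r) - mass (X - r)"
proof -
  consider (a) "X + r \<le> 1/2" | (b) "X \<le> 1/2" "X + r > 1/2" "X - r \<ge> -1/2"
    | (c) "X \<le> 1/2" "X - r < -1/2" | (d) "X > 1/2" "X - r > 1/2"
    | (e) "X > 1/2" "X - r \<le> 1/2" "X - r \<ge> -1/2" | (f) "X > 1/2" "X - r < -1/2"
    by linarith
  then show ?thesis
  proof cases
    case a
    then have "mass (X + r) - mass (X - r) = r" "envelope X = 1"
      using X r by (simp_all add: mass_def envelope_def abs_if field_simps)
    then show ?thesis using r by (simp add: field_simps)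
  next
    case b
    have "mass (X + r) - mass (X - r) = 1/2 - 1 / (8 * (X + r)) - (X - r) / 2"
      using X r b by (simp add: mass_right mass_middle)
    moreover have "envelope X = 1" using X b by (simp add: envelope_def)
    moreover have "r / (1 + r) \<le> 1/2 - 1 / (8 * (X + r)) - (X - r) / 2"
    proof -
      \<comment> \<open>\<open>d\<close> is the depth of \<open>X\<close> inside the flat part.
        After clearing denominators the claim is a polynomial inequality that follows from
        \<open>d * d \<le> d * r\<close> and \<open>d * d * r \<le> r * r * r\<close>.\<close>
      define d where "d = 1/2 - X"
      have X': "X = 1/2 - d" and d: "0 \<le> d" "d < r" using b by (auto simp: d_def)
      have pos: "0 < 8 * (X + r) * (1 + r)" using X r by simp
      have "8 * (X + r) * (1 / (8 * (X + r))) = 1" "(1 + r) * (r / (1 + r)) = r"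
        using X r by auto
      moreover have "8 * (X + r) * (1 + r) * (1/2 - a - (X - r) / 2 - b)
          = (4 * (X + r) - 8 * (X + r) * a - 4 * (X + r) * (X - r)) * (1 + r)
            - 8 * (X + r) * ((1 + r) * b)" for a b
        by (simp add: field_simps)
      ultimately have "8 * (X + r) * (1 + r) * (1/2 - 1 / (8 * (X + r)) - (X - r) / 2 - r / (1 + r))
          = (4 * (X + r) - 1 - 4 * (X + r) * (X - r)) * (1 + r) - 8 * (X + r) * r"
        by (simp only: mult_1_right)
      also have "\<dots> = 8 * d * r + 4 * r * r * r - 4 * d * d * (1 + r)"
        by (simp add: X' algebra_simps)
      also have "\<dots> \<ge> 0"
      proof -
        have "d * d \<le> d * r" "d * (d * r) \<le> r * r * r"
          using d r by (auto intro!: mult_mono mult_left_mono simp: mult.assoc)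
        moreover have "0 \<le> d * r" using d r by simp
        ultimately show ?thesis by (simp add: algebra_simps)
      qed
      finally have "0 \<le> 1/2 - 1 / (8 * (X + r)) - (X - r) / 2 - r / (1 + r)"
        using pos by (meson mult_pos_neg not_less)
      then show ?thesis by simp
    qed
    ultimately show ?thesis by simp
  next
    case c
    have lt: "X < r" "X \<le> r - 1/2" using X c by auto
    have "mass (X + r) - mass (X - r) = 1 - 1 / (8 * (X + r)) - 1 / (8 * (r - X))"
      using X r c lt mass_right[of "X + r"] mass_right[of "r - X"] mass_minus[of "r - X"] by simp
    also have "\<dots> = 1 - r / (4 * (r\<^sup>2 - X\<^sup>2))"
      using X r lt recip_add_sub_cross(1)[of "X + r" "r - X"]
      by (simp add: power2_eq_square square_diff_square_factored mult.commute add.commute)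
    finally have m: "mass (X + r) - mass (X - r) = 1 - r / (4 * (r\<^sup>2 - X\<^sup>2))" .
    have p: "r\<^sup>2 - X\<^sup>2 > 0" using X lt by (simp add: power_strict_mono)
    \<comment> \<open>Of the two bounds \<open>X \<le> 1/2\<close> and
      \<open>X \<le> r - 1/2\<close>, the first is the sharper one for \<open>1 \<le> r\<close>, the
      second for \<open>r < 1\<close>.\<close>
    have "r * (1 + r) \<le> 4 * (r\<^sup>2 - X\<^sup>2)"
    proof (cases "1 \<le> r")
      case True
      have "X\<^sup>2 \<le> (1/2)\<^sup>2" using X c by (intro power_mono) auto
      moreover have "1 * r \<le> r * r" "1 \<le> r * r" using True mult_mono[of 1 r 1 r] by auto
      ultimately show ?thesis by (simp add: power2_eq_square algebra_simps)
    next
      case False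
      have "X\<^sup>2 \<le> (r - 1/2)\<^sup>2" using X lt by (intro power_mono) auto
      then have 1: "X\<^sup>2 \<le> r\<^sup>2 - r + 1/4" by (simp add: power2_eq_square field_simps)
      have "0 \<le> (1 - r) * (r - 1/2)" using False lt X by simp
      then have 2: "2 * r\<^sup>2 \<le> 3 * r - 1" by (simp add: power2_eq_square field_simps)
      have 3: "r * (1 + r) = r + r\<^sup>2" by (simp add: power2_eq_square algebra_simps)
      have 4: "1/2 \<le> r" using lt(2) X by linarith
      show ?thesis unfolding 3 using 1 2 4 by argo
    qed
    then have "r / (4 * (r\<^sup>2 - X\<^sup>2)) \<le> 1 / (1 + r)" using p r by (simp add: field_simps)
    moreover have "r / (1 + r) = 1 - 1 / (1 + r)" using r by (simp add: field_simps)
    moreover have "envelope X = 1" using X c by (simp add: envelope_def)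
    ultimately show ?thesis using m by simp
  next
    case d
    \<comment> \<open>The density is convex on this tail, so the arc has at least the mass given by
      its midpoint density, which is \<open>r * envelope X\<close>.\<close>
    have "mass (X + r) - mass (X - r) = 1 / (8 * (X - r)) - 1 / (8 * (X + r))"
      using X r d by (simp add: mass_right)
    also have "\<dots> = r / (4 * (X\<^sup>2 - r\<^sup>2))"
      using X r d recip_add_sub_cross(2)[of "X - r" "X + r"]
      by (simp add: power2_eq_square square_diff_square_factored mult.commute add.commute)
    finally have m: "mass (X + r) - mass (X - r) = r / (4 * (X\<^sup>2 - r\<^sup>2))" .
    have "r\<^sup>2 < X\<^sup>2" using r d by (intro power_strict_mono) auto
    then have "r / (4 * X\<^sup>2) \<le> r / (4 * (X\<^sup>2 - r\<^sup>2))" using r d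
      by (intro divide_left_mono) auto
    moreover have "r / (1 + r) * (1 / (4 * X\<^sup>2)) \<le> r * (1 / (4 * X\<^sup>2))"
      using r by (intro mult_right_mono) (auto simp: field_simps)
    ultimately show ?thesis using m d by (simp add: envelope_def)
  next
    case e
    \<comment> \<open>\<open>y\<close> is the distance from the breakpoint 1/2 to the centre and
      \<open>v\<close> the length of the arc on the flat side. In these variables the
      cross-multiplied claim compares polynomials with non-negative coefficients.\<close>
    define y where "y = X - 1/2"
    define v where "v = r - y"
    have y: "0 < y" "X = 1/2 + y" and v: "0 \<le> v" "r = y + v" using e by (auto simp: y_def v_def)
    have "mass (X + r) - mass (X - r) = 1/2 - 1 / (8 * (X + r)) - (X - r) / 2"
      using X r e by (simp add: mass_right mass_middle)
    also have "\<dots> = (2 * (y + v) + 4 * y * v + 2 * v\<^sup>2) / (2 * (1 + 4 * y + 2 * v))"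
      using y(1) v(1) unfolding y(2) v(2) by (simp add: field_simps power2_eq_square)
    finally have m: "mass (X + r) - mass (X - r)
        = (2 * (y + v) + 4 * y * v + 2 * v\<^sup>2) / (2 * (1 + 4 * y + 2 * v))" .
    have "(y + v) * (1 + 4 * y + 2 * v) \<le> (y + v + 2 * y * v + v\<^sup>2) * ((1 + y + v) * (1 + 2 * y)\<^sup>2)"
    proof -
      \<comment> \<open>Only the constant and linear terms of the product are kept.\<close>
      have "1 + 5 * y + v \<le> (1 + y + v) * (1 + 2 * y)\<^sup>2"
        using y v(1) by (simp add: power2_eq_square algebra_simps)
      then have "(y + v + 2 * y * v + v\<^sup>2) * (1 + 5 * y + v)
          \<le> (y + v + 2 * y * v + v\<^sup>2) * ((1 + y + v) * (1 + 2 * y)\<^sup>2)"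
        using y(1) v(1) by (intro mult_left_mono) auto
      moreover have "(y + v) * (1 + 4 * y + 2 * v) + (y\<^sup>2 + 2 * y * v + (2 * y * v + v\<^sup>2) * (5 * y + v))
          = (y + v + 2 * y * v + v\<^sup>2) * (1 + 5 * y + v)"
        by (simp add: power2_eq_square algebra_simps)
      moreover have "0 \<le> y\<^sup>2 + 2 * y * v + (2 * y * v + v\<^sup>2) * (5 * y + v)"
        using y(1) v(1) by simp
      ultimately show ?thesis by linarith
    qed
    then have "(y + v) / ((1 + y + v) * (1 + 2 * y)\<^sup>2) \<le> (2 * (y + v) + 4 * y * v + 2 * v\<^sup>2) / (2 * (1 + 4 * y + 2 * v))"
      using y v by (simp add: divide_simps) (simp add: algebra_simps)
    moreover have "r / (1 + r) * envelope X = (y + v) / ((1 + y + v) * (1 + 2 * y)\<^sup>2)"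
    proof -
      have "4 * X\<^sup>2 = (1 + 2 * y)\<^sup>2" by (simp add: y(2) power2_eq_square algebra_simps)
      then show ?thesis using e by (simp add: envelope_def v(2) add.assoc)
    qed
    ultimately show ?thesis using m by simp
  next
    case f
    have lt: "X < r" "X \<le> r - 1/2" using X f by auto
    have "mass (X + r) - mass (X - r) = 1 - 1 / (8 * (X + r)) - 1 / (8 * (r - X))"
      using X r f lt mass_right[of "X + r"] mass_right[of "r - X"] mass_minus[of "r - X"] by simp
    also have "\<dots> = 1 - r / (4 * (r\<^sup>2 - X\<^sup>2))"
      using X r lt recip_add_sub_cross(1)[of "X + r" "r - X"]
      by (simp add: power2_eq_square square_diff_square_factored mult.commute add.commute)
    finally have m: "mass (X + r) - mass (X - r) = 1 - r / (4 * (r\<^sup>2 - X\<^sup>2))" .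
    \<comment> \<open>Now \<open>envelope X = 1 / z\<close> and the increment is
      \<open>1 - r / w\<close>, so the claim reads
      \<open>r * (1 + r) * z \<le> w * ((1 + r) * z - r)\<close>. For \<open>2 \<le> z\<close> the
      bound \<open>3 * r \<le> w\<close> suffices; for \<open>z < 2\<close> the bound
      \<open>2 * (r * r) \<le> w\<close> does.\<close>
    define z where "z = 4 * X\<^sup>2"
    define w where "w = 4 * r\<^sup>2 - z"
    have r1: "1 < r" using f by linarith
    have z1: "1 < z" using f power_strict_mono[of "1/2" X 2] by (simp add: z_def power2_eq_square)
    have "X\<^sup>2 \<le> (r - 1/2)\<^sup>2" using X lt by (intro power_mono) auto
    then have w1: "3 * r \<le> w" using r1 by (simp add: w_def z_def power2_eq_square algebra_simps)
    have "0 \<le> w * ((1 + r) * z - r) - r * (1 + r) * z"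
    proof -
      have q: "0 \<le> (1 + r) * z - r"
      proof -
        have "1 + r \<le> (1 + r) * z" using r1 z1 by simp
        then show ?thesis by linarith
      qed
      show ?thesis
      proof (cases "2 \<le> z")
        case True
        have "w * ((1 + r) * z - r) - r * (1 + r) * z
            = (w * ((1 + r) * z - r) - 3 * r * ((1 + r) * z - r))
              + (z * (2 * (r * (1 + r))) - 2 * (2 * (r * (1 + r)))) + (4 * r + r * r)"
          by (simp add: algebra_simps)
        moreover have "3 * r * ((1 + r) * z - r) \<le> w * ((1 + r) * z - r)"
          using w1 q by (rule mult_right_mono)
        moreover have "2 * (2 * (r * (1 + r))) \<le> z * (2 * (r * (1 + r)))"
          using True r1 by (intro mult_right_mono) auto
        moreover have "0 \<le> 4 * r + r * r" using r1 by simp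
        ultimately show ?thesis by linarith
      next
        case False
        have rr: "r \<le> r * r" using r1 by simp
        then have "2 * (r * r) \<le> w" unfolding w_def power2_eq_square using False r1 by linarith
        then have "2 * (r * r) * ((1 + r) * z - r) \<le> w * ((1 + r) * z - r)"
          using q by (rule mult_right_mono)
        moreover have nn: "0 \<le> (1 + r) * (2 * (r * r) - r)"
          using r1 rr by (intro mult_nonneg_nonneg) linarith+
        moreover have "(1 + r) * (2 * (r * r) - r) \<le> z * ((1 + r) * (2 * (r * r) - r))"
          using mult_right_mono[OF less_imp_le[OF z1] nn] by (simp only: mult_1_left)
        moreover have "w * ((1 + r) * z - r) - r * (1 + r) * z
            = (w * ((1 + r) * z - r) - 2 * (r * r) * ((1 + r) * z - r))
              + (z * ((1 + r) * (2 * (r * r) - r)) - (1 + r) * (2 * (r * r) - r)) + (r * r - r)"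
          by (simp add: algebra_simps)
        ultimately show ?thesis using rr by linarith
      qed
    qed
    moreover have pos: "0 < w" "0 < (1 + r) * z" using r1 z1 w1 by auto
    ultimately have "0 \<le> (w * ((1 + r) * z - r) - r * (1 + r) * z) / (w * ((1 + r) * z))"
      by (simp only: divide_nonneg_pos mult_pos_pos)
    moreover have "(w * (c - r) - r * c) / (w * c) = 1 - r / w - r / c" if "0 < c" for c
      using that pos(1) by (simp add: field_simps)
    note this[OF pos(2)]
    ultimately have "r / (1 + r) * (1 / z) \<le> 1 - r / w"
      by (simp add: mult.assoc)
    then show ?thesis using m f by (simp add: envelope_def z_def w_def algebra_simps)
  qed
qed

lemma mass_increment_ge:
  assumes "0 < r"
  shows "r / (1 + r) * envelope X \<le> mass (X + r) - mass (X - r)"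
proof (cases "0 \<le> X")
  case True
  then show ?thesis using mass_increment_ge_nonneg assms by blast
next
  case False
  moreover have "envelope (- X) = envelope X" by (simp add: envelope_def)
  ultimately show ?thesis
    using mass_increment_ge_nonneg[of "-X" r] assms mass_minus[of "X - r"] mass_minus[of "X + r"]
    by (simp del: times_divide_eq_left)
qed

section \<open>Fourier analysis of the residue sets\<close>

definition ee :: "real \<Rightarrow> complex" where
  "ee x = cis (2 * pi * x)"

lemma ee_add: "ee (x + y) = ee x * ee y"
  by (simp add: ee_def cis_mult distrib_left)

lemma cnj_ee: "cnj (ee x) = ee (- x)"
  by (simp add: ee_def cis_cnj)

lemma norm_ee [simp]: "cmod (ee x) = 1"
  by (simp add: ee_def)

lemma ee_Ints [simp]: "x \<in> \<int> \<Longrightarrow> ee x = 1"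
  by (simp add: ee_def)

lemma ee_add_Ints: "x \<in> \<int> \<Longrightarrow> ee (y + x) = ee y"
  by (simp add: ee_add)

lemma ee_of_nat_mult: "ee (real n * x) = ee x ^ n"
  by (simp add: ee_def Complex.DeMoivre mult.left_commute)

lemma ee_eq_1_imp_Ints:
  assumes "ee x = 1"
  shows "x \<in> \<int>"
proof -
  have "cos (2 * pi * x) = 1" using assms by (simp add: ee_def complex_eq_iff)
  then obtain n :: int where "2 * pi * x = of_int n * 2 * pi"
    unfolding cos_one_2pi_int by blast
  then show ?thesis by simp
qed

lemma cmod_sum_sq:
  "complex_of_real ((cmod (\<Sum>n\<in>I. of_real (u n) * ee (v n)))\<^sup>2)
     = (\<Sum>m\<in>I. \<Sum>n\<in>I. of_real (u m * u n) * ee (v m - v n))"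
proof -
  have "complex_of_real ((cmod (\<Sum>n\<in>I. of_real (u n) * ee (v n)))\<^sup>2)
     = (\<Sum>m\<in>I. of_real (u m) * ee (v m)) * cnj (\<Sum>n\<in>I. of_real (u n) * ee (v n))"
    using complex_norm_square by auto
  also have "\<dots> = (\<Sum>m\<in>I. \<Sum>n\<in>I. of_real (u m * u n) * ee (v m - v n))"
    by (simp add: sum_product cnj_ee diff_conv_add_uminus ee_add mult_ac del: add_uminus_conv_diff)
  finally show ?thesis .
qed

text \<open>Orthogonality by a geometric sum. The residues run over \<open>{0<..q}\<close> because
  \<open>totatives q\<close> lies there, so that such sums can be split by exact
  denominator.\<close>

lemma sum_ee_residues:
  assumes "0 < q"
  shows "(\<Sum>b\<in>{0<..q}. ee (of_int k * (real b / real q))) = (if int q dvd k then of_nat q else 0)"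
proof -
  define z where "z = ee (of_int k / real q)"
  have "ee (of_int k * (real b / real q)) = z ^ b" for b
    using ee_of_nat_mult[of b "of_int k / real q"] by (simp add: z_def mult.commute)
  moreover have "{0<..q} = Suc ` {..<q}"
    by (simp add: image_Suc_lessThan atLeastSucAtMost_greaterThanAtMost)
  ultimately have *: "(\<Sum>b\<in>{0<..q}. ee (of_int k * (real b / real q))) = z * (\<Sum>b<q. z ^ b)"
    by (simp add: sum.reindex sum_distrib_left)
  have zq: "z ^ q = 1"
    using ee_of_nat_mult[of q "of_int k / real q"] assms by (simp add: z_def)
  show ?thesis
  proof (cases "int q dvd k")
    case True
    then obtain l where "k = int q * l" by blast
    then have "z = 1" using assms by (simp add: z_def)
    then show ?thesis using * True by simp
  next
    case False
    have "z \<noteq> 1"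
    proof
      assume "z = 1"
      then obtain l where "of_int k / real q = of_int l"
        unfolding z_def by (blast dest: ee_eq_1_imp_Ints elim: Ints_cases)
      then have "of_int k = (of_int (l * int q) :: real)" using assms by (simp add: field_simps)
      then show False using False by (metis dvd_triv_right of_int_eq_iff)
    qed
    then show ?thesis using * False zq by (simp add: sum_gp_strict)
  qed
qed

text \<open>Grouping by \<open>gcd b q = d\<close> leaves fractions of exact denominator
  \<open>q div d\<close>; the involution \<open>d \<mapsto> q div d\<close> of the divisors
  finishes.\<close>

lemma sum_fractions_by_denominator:
  fixes f :: "real \<Rightarrow> 'a::comm_monoid_add"
  assumes "0 < q"
  shows "(\<Sum>b\<in>{0<..q}. f (real b / real q)) = (\<Sum>d | d dvd q. \<Sum>a\<in>totatives d. f (real a / real d))"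
proof -
  have "(\<Sum>b\<in>{0<..q}. f (real b / real q))
      = (\<Sum>d | d dvd q. \<Sum>b\<in>{b \<in> {0<..q}. gcd b q = d}. f (real b / real q))"
    using assms by (intro sum.group[symmetric]) auto
  also have "\<dots> = (\<Sum>d | d dvd q. \<Sum>a\<in>totatives (q div d). f (real a / real (q div d)))"
  proof (rule sum.cong[OF refl])
    fix d assume "d \<in> {d. d dvd q}"
    then have d: "d dvd q" by simp
    have "(\<Sum>b\<in>{b \<in> {0<..q}. gcd b q = d}. f (real b / real q))
        = (\<Sum>a\<in>totatives (q div d). f (real (a * d) / real q))"
      by (rule sum.reindex_bij_betw[symmetric, OF bij_betw_totatives_gcd_eq[OF d assms]])
    moreover have "real (a * d) / real q = real a / real (q div d)" for a
      using d assms by (auto elim!: dvdE)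
    ultimately show "(\<Sum>b\<in>{b \<in> {0<..q}. gcd b q = d}. f (real b / real q))
        = (\<Sum>a\<in>totatives (q div d). f (real a / real (q div d)))" by simp
  qed
  also have "\<dots> = (\<Sum>d | d dvd q. \<Sum>a\<in>totatives d. f (real a / real d))"
    by (rule sum.reindex_bij_witness[of _ "\<lambda>d. q div d" "\<lambda>d. q div d"])
      (use assms in \<open>auto simp: div_dvd_iff_mult dvd_div_iff_mult elim!: dvdE\<close>)
  finally show ?thesis .
qed

section \<open>Multiplicativity over coprime factors\<close>

lemma prime_factors_coprime_disjoint:
  "coprime a b \<Longrightarrow> prime_factors a \<inter> prime_factors b = {}" for a b :: nat
  by (auto simp: in_prime_factors_iff dest: coprime_common_divisor_nat not_prime_unit)

lemma multiplicity_coprime_mult: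
  fixes a b :: nat
  assumes "0 < a" "0 < b" "coprime a b" "p \<in> prime_factors a"
  shows "multiplicity p (a * b) = multiplicity p a" "multiplicity p (b * a) = multiplicity p a"
proof -
  have "\<not> p dvd b"
    using prime_factors_coprime_disjoint[OF assms(3)] assms by (auto simp: in_prime_factors_iff)
  then show "multiplicity p (a * b) = multiplicity p a"
    using assms by (simp add: in_prime_factors_iff prime_elem_multiplicity_mult_distrib not_dvd_imp_multiplicity_0)
  then show "multiplicity p (b * a) = multiplicity p a" by (simp add: mult.commute)
qed

lemma prod_prime_factors_coprime_mult:
  fixes f :: "nat \<Rightarrow> nat \<Rightarrow> 'a::comm_monoid_mult"
  assumes "0 < a" "0 < b" "coprime a b"
  shows "(\<Prod>p\<in>prime_factors (a * b). f p (multiplicity p (a * b)))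
       = (\<Prod>p\<in>prime_factors a. f p (multiplicity p a)) * (\<Prod>p\<in>prime_factors b. f p (multiplicity p b))"
proof -
  have "prime_factors (a * b) = prime_factors a \<union> prime_factors b"
    using assms by (simp add: prime_factors_product)
  then show ?thesis
    using assms prime_factors_coprime_disjoint[OF assms(3)]
    by (simp add: prod.union_disjoint multiplicity_coprime_mult coprime_commute)
qed

text \<open>A divisor of \<open>a * b\<close> splits uniquely into a divisor of \<open>a\<close> and
  a divisor of \<open>b\<close>, which turns the divisor sum into a double sum.\<close>

lemma sum_divisors_coprime_mult:
  fixes f :: "nat \<Rightarrow> 'a::comm_semiring_0"
  assumes "0 < a" "0 < b" "coprime a b"
    and f: "\<And>c d. c dvd a \<Longrightarrow> d dvd b \<Longrightarrow> f (c * d) = f c * f d"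
  shows "(\<Sum>d | d dvd a * b. f d) = (\<Sum>d | d dvd a. f d) * (\<Sum>d | d dvd b. f d)"
proof -
  have "inj_on (\<lambda>(c, d). c * d) ({c. c dvd a} \<times> {d. d dvd b})"
  proof (rule inj_onI, clarsimp)
    fix c d c' d' assume *: "c dvd a" "d dvd b" "c' dvd a" "d' dvd b" "c * d = c' * d'"
    have "coprime c d'" "coprime c' d" using * assms(3) by (blast intro: coprime_divisors)+
    then have "c dvd c'" "c' dvd c" using *(5)
      by (metis coprime_dvd_mult_left_iff dvd_triv_left)+
    then have "c = c'" by (rule dvd_antisym)
    moreover have "c \<noteq> 0" using * assms(1) by auto
    ultimately show "c = c' \<and> d = d'" using *(5) by auto
  qed
  moreover have "(\<lambda>(c, d). c * d) ` ({c. c dvd a} \<times> {d. d dvd b}) = {d. d dvd a * b}"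
    by (auto simp: mult_dvd_mono image_iff) (metis division_decomp)
  ultimately have "(\<Sum>d | d dvd a * b. f d) = (\<Sum>(c, d)\<in>{c. c dvd a} \<times> {d. d dvd b}. f (c * d))"
    using sum.reindex[of "\<lambda>(c, d). c * d" "{c. c dvd a} \<times> {d. d dvd b}" f]
    by (simp add: case_prod_beta comp_def)
  also have "\<dots> = (\<Sum>d | d dvd a. f d) * (\<Sum>d | d dvd b. f d)"
    by (simp add: sum_product sum.cartesian_product[symmetric] f)
  finally show ?thesis .
qed

section \<open>Cardinalities of the residue sets and the divisor sum of \<open>g_fun\<close>\<close>

locale johnsen_gallagher_family =
  fixes Q :: real and K :: "nat \<Rightarrow> int set"
  assumes residues: "residue_sets Q K" and multiplicative: "multiplicative_sets Q K"
    and consistent: "consistent_sets Q K" and equidistributed: "johnsen_gallagher Q K"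
begin

lemma moduli_pos: "q \<in> moduli Q \<Longrightarrow> 0 < q"
  by (auto simp: moduli_def)

lemma moduli_dvd:
  assumes "q \<in> moduli Q" "d dvd q"
  shows "d \<in> moduli Q"
proof -
  have "0 < q" using assms by (auto simp: moduli_def)
  then have "d \<le> q" "0 < d" using assms(2) by (auto intro: dvd_imp_le dvd_pos_nat)
  then show ?thesis using assms(1) by (auto simp: moduli_def)
qed

lemma K_subset: "q \<in> moduli Q \<Longrightarrow> K q \<subseteq> {0..<int q}"
  using residues unfolding residue_sets_def residue_ring_def by fastforce

lemma finite_K: "q \<in> moduli Q \<Longrightarrow> finite (K q)"
  using K_subset finite_subset by blast

lemma card_K_pos: "q \<in> moduli Q \<Longrightarrow> 0 < card (K q)"
  using residues finite_K by (auto simp: residue_sets_def card_gt_0_iff)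

lemma card_K_1: "Suc 0 \<in> moduli Q \<Longrightarrow> card (K (Suc 0)) = 1"
proof -
  assume *: "Suc 0 \<in> moduli Q"
  then have "K (Suc 0) \<subseteq> {0}" using K_subset[OF *] by auto
  moreover have "K (Suc 0) \<noteq> {}" using card_K_pos[OF *] by auto
  ultimately have "K (Suc 0) = {0}" by auto
  then show ?thesis by simp
qed

lemma K_mod: "q \<in> moduli Q \<Longrightarrow> d dvd q \<Longrightarrow> k \<in> K q \<Longrightarrow> k mod int d \<in> K d"
  using consistent by (auto simp: consistent_sets_def)

text \<open>Passes from prime powers to arbitrary coprime factors:
  \<open>x mod int a \<in> K a\<close> unfolds into the conditions at the primes of
  \<open>a\<close>, and those for \<open>a\<close> and \<open>b\<close> together are the ones for
  \<open>a * b\<close>.\<close>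

lemma K_coprime_mult:
  assumes q: "a * b \<in> moduli Q" and ab: "coprime a b"
  shows "K (a * b) = {x \<in> {0..<int (a * b)}. x mod int a \<in> K a \<and> x mod int b \<in> K b}"
proof -
  have a: "a \<in> moduli Q" and b: "b \<in> moduli Q" using moduli_dvd[OF q] by auto
  note pos = moduli_pos[OF a] moduli_pos[OF b]
  have K: "x \<in> K q \<longleftrightarrow> x \<in> {0..<int q} \<and>
      (\<forall>p\<in>prime_factors q. x mod int (p ^ multiplicity p q) \<in> K (p ^ multiplicity p q))"
    if "q \<in> moduli Q" for q x
    using multiplicative that by (auto simp: multiplicative_sets_def residue_ring_def)
  have red: "x mod int c \<in> K c \<longleftrightarrow>
      (\<forall>p\<in>prime_factors c. x mod int (p ^ multiplicity p c) \<in> K (p ^ multiplicity p c))"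
    if "c \<in> moduli Q" for c x
  proof -
    have "x mod int c mod int (p ^ multiplicity p c) = x mod int (p ^ multiplicity p c)" for p
      by (intro mod_mod_cancel) (simp only: of_nat_dvd_iff multiplicity_dvd)
    then show ?thesis using K[OF that, of "x mod int c"] moduli_pos[OF that] by simp
  qed
  have un: "prime_factors (a * b) = prime_factors a \<union> prime_factors b"
    using pos by (simp add: prime_factors_product)
  have A: "multiplicity p (a * b) = multiplicity p a" if "p \<in> prime_factors a" for p
    using multiplicity_coprime_mult(1) pos ab that by blast
  have B: "multiplicity p (a * b) = multiplicity p b" if "p \<in> prime_factors b" for p
    using multiplicity_coprime_mult(2) pos ab that by (simp add: coprime_commute)
  show ?thesis
  proof (rule Set.set_eqI)
    fix x
    have "x mod int a \<in> K a \<longleftrightarrow>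
        (\<forall>p\<in>prime_factors a. x mod int (p ^ multiplicity p (a * b)) \<in> K (p ^ multiplicity p (a * b)))"
      unfolding red[OF a] by (rule ball_cong[OF refl]) (simp only: A)
    moreover have "x mod int b \<in> K b \<longleftrightarrow>
        (\<forall>p\<in>prime_factors b. x mod int (p ^ multiplicity p (a * b)) \<in> K (p ^ multiplicity p (a * b)))"
      unfolding red[OF b] by (rule ball_cong[OF refl]) (simp only: B)
    ultimately show "x \<in> K (a * b) \<longleftrightarrow>
        x \<in> {x \<in> {0..<int (a * b)}. x mod int a \<in> K a \<and> x mod int b \<in> K b}"
      by (simp only: K[OF q] un ball_Un mem_Collect_eq)
  qed
qed

lemma card_K_coprime_mult:
  assumes q: "a * b \<in> moduli Q" and ab: "coprime a b"
  shows "card (K (a * b)) = card (K a) * card (K b)"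
proof -
  have a: "a \<in> moduli Q" and b: "b \<in> moduli Q" using moduli_dvd[OF q] by auto
  note pos = moduli_pos[OF a] moduli_pos[OF b]
  have "bij_betw (\<lambda>x. (x mod int a, x mod int b)) (K (a * b)) (K a \<times> K b)"
  proof (rule bij_betw_imageI)
    show "inj_on (\<lambda>x. (x mod int a, x mod int b)) (K (a * b))"
    proof (rule inj_onI)
      fix x y assume x: "x \<in> K (a * b)" and y: "y \<in> K (a * b)"
        and "(x mod int a, x mod int b) = (y mod int a, y mod int b)"
      then have "[x = y] (mod int a)" "[x = y] (mod int b)" by (auto simp: cong_def)
      then have "[x = y] (mod (int a * int b))" using ab by (intro coprime_cong_mult) auto
      moreover have "x \<in> {0..<int a * int b}" "y \<in> {0..<int a * int b}"
        using x y K_subset[OF q] by auto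
      ultimately show "x = y" by (simp add: cong_def)
    qed
    show "(\<lambda>x. (x mod int a, x mod int b)) ` K (a * b) = K a \<times> K b"
    proof (intro equalityI subsetI)
      fix z assume "z \<in> K a \<times> K b"
      then obtain s t where z: "z = (s, t)" "s \<in> K a" "t \<in> K b" by auto
      obtain x where x: "[x = s] (mod int a)" "[x = t] (mod int b)"
        using binary_chinese_remainder_int[of "int a" "int b" s t] ab by auto
      define w where "w = x mod int (a * b)"
      have "w mod int a = x mod int a" "w mod int b = x mod int b"
        by (simp_all add: w_def mod_mod_cancel)
      then have "w mod int a = s" "w mod int b = t"
        using x z K_subset[OF a] K_subset[OF b] by (auto simp: cong_def)
      moreover from this have "w \<in> K (a * b)"
        using z pos unfolding K_coprime_mult[OF q ab] by (simp add: w_def)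
      ultimately show "z \<in> (\<lambda>x. (x mod int a, x mod int b)) ` K (a * b)"
        using z(1) by force
    qed (use K_mod[OF q dvd_triv_left] K_mod[OF q dvd_triv_right] in auto)
  qed
  from bij_betw_same_card[OF this] show ?thesis by (simp add: card_cartesian_product)
qed

lemma g_fun_coprime_mult:
  "0 < a \<Longrightarrow> 0 < b \<Longrightarrow> coprime a b \<Longrightarrow> g_fun K (a * b) = g_fun K a * g_fun K b"
  unfolding g_fun_def by (rule prod_prime_factors_coprime_mult)

text \<open>The values at the powers of \<open>p\<close> telescope, starting from
  \<open>g_fun K 1 = 1\<close> and \<open>card (K 1) = 1\<close>.\<close>

lemma sum_g_fun_prime_power:
  assumes "prime p" "p ^ e \<in> moduli Q"
  shows "(\<Sum>d | d dvd p ^ e. g_fun K d) = real (p ^ e) / real (card (K (p ^ e)))"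
proof -
  have "{d. d dvd p ^ e} = (\<lambda>j. p ^ j) ` {..e}"
    using assms(1) by (auto simp: divides_primepow_nat)
  moreover have "inj_on (\<lambda>j. p ^ j) {..e}"
    using assms(1) by (auto intro!: inj_onI dest: prime_gt_1_nat)
  ultimately have "(\<Sum>d | d dvd p ^ e. g_fun K d) = (\<Sum>j\<le>e. g_fun K (p ^ j))"
    by (simp add: sum.reindex)
  also have "\<dots> = real (p ^ e) / real (card (K (p ^ e)))"
    using assms(2)
  proof (induction e)
    case 0
    then show ?case using card_K_1 by (simp add: g_fun_def)
  next
    case (Suc e)
    have "p ^ e \<in> moduli Q" using moduli_dvd[OF Suc.prems] by simp
    moreover have "g_fun K (p ^ Suc e) = real (p ^ Suc e) / real (card (K (p ^ Suc e)))
        - real (p ^ e) / real (card (K (p ^ e)))"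
      using assms(1) by (simp add: g_fun_def prime_factors_power prime_prime_factors del: power_Suc)
    ultimately show ?case using Suc.IH by simp
  qed
  finally show ?thesis .
qed

text \<open>Identifies \<open>g_fun K\<close> as the Moebius inverse of
  \<open>q / card (K q)\<close>. Both sides are multiplicative, so the full power of one prime is
  split off and the induction treats the cofactor.\<close>

lemma sum_g_fun:
  assumes "q \<in> moduli Q"
  shows "(\<Sum>d | d dvd q. g_fun K d) = real q / real (card (K q))"
  using assms
proof (induction q rule: less_induct)
  case (less q)
  show ?case
  proof (cases "q = 1")
    case True
    then show ?thesis using card_K_1 less.prems by (simp add: g_fun_def)
  next
    case False
    then obtain p where p: "prime p" "p dvd q" using prime_factor_nat by blast
    have q: "0 < q" using less.prems moduli_pos by blast
    define e where "e = multiplicity p q"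
    have "q \<noteq> 0" "\<not> is_unit p" using q p not_prime_unit by auto
    then obtain m where m: "q = p ^ e * m" "\<not> p dvd m"
      unfolding e_def by (rule multiplicity_decompose')
    have co: "coprime (p ^ e) m" using p m by (simp add: prime_imp_coprime)
    have pos: "0 < p ^ e" "0 < m" using q m by auto
    have mod: "p ^ e \<in> moduli Q" "m \<in> moduli Q" using moduli_dvd[OF less.prems] m(1) by auto
    have "0 < e" using p q by (simp add: e_def prime_multiplicity_gt_zero_iff)
    then have "1 < p ^ e" using prime_gt_1_nat[OF p(1)] by (rule one_less_power[rotated])
    then have "m < q" using m(1) pos by simp
    have "(\<Sum>d | d dvd q. g_fun K d) = (\<Sum>d | d dvd p ^ e. g_fun K d) * (\<Sum>d | d dvd m. g_fun K d)"
      unfolding m(1)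
    proof (rule sum_divisors_coprime_mult[OF pos co])
      fix c d assume c: "c dvd p ^ e" and d: "d dvd m"
      show "g_fun K (c * d) = g_fun K c * g_fun K d"
        by (rule g_fun_coprime_mult[OF dvd_pos_nat[OF pos(1) c] dvd_pos_nat[OF pos(2) d]
              coprime_divisors[OF c d co]])
    qed
    also have "\<dots> = real q / real (card (K q))"
      using less.IH[OF \<open>m < q\<close> mod(2)] sum_g_fun_prime_power[OF p(1) mod(1)]
        card_K_coprime_mult[of "p ^ e" m] co less.prems m(1) by simp
    finally show ?thesis .
  qed
qed

text \<open>Fourier coefficients of \<open>q / card (K q)\<close> times the indicator of \<open>K q\<close>. The Johnsen-Gallagher
  condition says exactly that they depend only on the fraction \<open>x\<close> and not on \<open>q\<close>.\<close>

definition K_hat :: "nat \<Rightarrow> real \<Rightarrow> complex" where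
  "K_hat q x = (\<Sum>k\<in>K q. ee (- of_int k * x)) / of_nat (card (K q))"

text \<open>A character of denominator \<open>d\<close> is constant on the fibres of reduction
  modulo \<open>d\<close>, and the Johnsen-Gallagher condition gives all fibres the same size. The
  average over \<open>K q\<close> is therefore the average over \<open>K d\<close>.\<close>

lemma K_hat_reduce:
  assumes q: "q \<in> moduli Q" and d: "d dvd q"
  shows "K_hat q (real a / real d) = K_hat d (real a / real d)"
proof -
  have d': "d \<in> moduli Q" using moduli_dvd q d by blast
  have per: "ee (- of_int k * (real a / real d)) = ee (- of_int y * (real a / real d))"
    if "k mod int d = y" for k y
  proof -
    define l where "l = k div int d"
    have "k = y + int d * l" using that by (auto simp: l_def)
    then have "- of_int k * (real a / real d)
        = - of_int y * (real a / real d) + of_int (- l * int a)"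
      using moduli_pos[OF d'] by (simp add: field_simps)
    then show ?thesis by (metis Ints_of_int ee_add_Ints)
  qed
  have "(\<Sum>k\<in>K q. ee (- of_int k * (real a / real d)))
      = (\<Sum>y\<in>K d. \<Sum>k\<in>{k \<in> K q. k mod int d = y}. ee (- of_int k * (real a / real d)))"
    using finite_K[OF q] finite_K[OF d'] K_mod[OF q d] by (intro sum.group[symmetric]) auto
  also have "\<dots> = (\<Sum>y\<in>K d. of_nat (card {k \<in> K q. k mod int d = y}) * ee (- of_int y * (real a / real d)))"
  proof (rule sum.cong[OF refl])
    fix y
    have "(\<Sum>k\<in>{k \<in> K q. k mod int d = y}. ee (- of_int k * (real a / real d)))
        = (\<Sum>k\<in>{k \<in> K q. k mod int d = y}. ee (- of_int y * (real a / real d)))"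
      by (rule sum.cong[OF refl], rule per) simp
    then show "(\<Sum>k\<in>{k \<in> K q. k mod int d = y}. ee (- of_int k * (real a / real d)))
        = of_nat (card {k \<in> K q. k mod int d = y}) * ee (- of_int y * (real a / real d))"
      by (simp only: sum_constant)
  qed
  also have "\<dots> = (\<Sum>y\<in>K d. of_real (real (card (K q)) / real (card (K d))) * ee (- of_int y * (real a / real d)))"
  proof (rule sum.cong[OF refl])
    fix y assume y: "y \<in> K d"
    then have "{k \<in> K q. k mod int d = y} = {x \<in> K q. [x = y] (mod int d)}"
      using K_subset[OF d'] by (auto simp: cong_def)
    then have "real (card {k \<in> K q. k mod int d = y}) = real (card (K q)) / real (card (K d))"
      using equidistributed q d y by (simp add: johnsen_gallagher_def)
    then show "of_nat (card {k \<in> K q. k mod int d = y}) * ee (- of_int y * (real a / real d))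
      = of_real (real (card (K q)) / real (card (K d))) * ee (- of_int y * (real a / real d))"
      by (metis of_real_of_nat_eq)
  qed
  also have "\<dots> = of_real (real (card (K q)) / real (card (K d))) * (\<Sum>y\<in>K d. ee (- of_int y * (real a / real d)))"
    by (simp only: sum_distrib_left)
  finally show ?thesis
    using card_K_pos[OF q] by (simp add: K_hat_def)
qed

text \<open>Fourier inversion at a point of \<open>K q\<close>, where the normalised indicator takes
  the value \<open>q / card (K q)\<close>.\<close>

lemma sum_K_hat:
  assumes q: "q \<in> moduli Q" and n: "n mod int q \<in> K q"
  shows "(\<Sum>b\<in>{0<..q}. K_hat q (real b / real q) * ee (of_int n * (real b / real q)))
       = of_real (real q / real (card (K q)))"
proof -
  have pos: "0 < q" using moduli_pos q by blast
  have "(\<Sum>b\<in>{0<..q}. K_hat q (real b / real q) * ee (of_int n * (real b / real q)))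
      = (\<Sum>b\<in>{0<..q}. \<Sum>k\<in>K q. ee (of_int (n - k) * (real b / real q))) / of_nat (card (K q))"
    by (simp add: K_hat_def sum_divide_distrib sum_distrib_right ee_add[symmetric] left_diff_distrib diff_divide_distrib)
  also have "(\<Sum>b\<in>{0<..q}. \<Sum>k\<in>K q. ee (of_int (n - k) * (real b / real q)))
      = (\<Sum>k\<in>K q. if int q dvd n - k then of_nat q else 0)"
    by (subst sum.swap) (simp only: sum_ee_residues[OF pos])
  also have "\<dots> = (\<Sum>k\<in>K q. if k = n mod int q then of_nat q else 0)"
  proof (rule sum.cong[OF refl])
    fix k assume "k \<in> K q"
    then have "k mod int q = k" using K_subset[OF q] by auto
    then have "int q dvd n - k \<longleftrightarrow> k = n mod int q" by (metis mod_eq_dvd_iff)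
    then show "(if int q dvd n - k then of_nat q else 0) = (if k = n mod int q then of_nat q else (0::complex))"
      by simp
  qed
  also have "\<dots> = of_nat q" using n finite_K[OF q] by simp
  finally show ?thesis by simp
qed

text \<open>Moebius inversion by strong induction: by \<open>sum_K_hat\<close> and
  \<open>K_hat_reduce\<close> the sums of exact denominator \<open>d dvd q\<close> add up to
  \<open>q / card (K q)\<close>, and so do the \<open>g_fun K d\<close>. Agreement at all proper
  divisors leaves agreement at \<open>q\<close>.\<close>

lemma sum_K_hat_primitive:
  assumes "q \<in> moduli Q" and "\<And>d. d dvd q \<Longrightarrow> n mod int d \<in> K d"
  shows "(\<Sum>a\<in>totatives q. K_hat q (real a / real q) * ee (of_int n * (real a / real q)))
       = of_real (g_fun K q)"
  using assms
proof (induction q rule: less_induct)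
  case (less q)
  let ?S = "\<lambda>d. \<Sum>a\<in>totatives d. K_hat d (real a / real d) * ee (of_int n * (real a / real d))"
  have pos: "0 < q" using moduli_pos less.prems(1) by blast
  have fin: "finite {d. d dvd q}" using pos by simp
  have "(\<Sum>d | d dvd q. ?S d) = (\<Sum>d | d dvd q. \<Sum>a\<in>totatives d. K_hat q (real a / real d) * ee (of_int n * (real a / real d)))"
    using K_hat_reduce[OF less.prems(1)] by simp
  also have "\<dots> = of_real (real q / real (card (K q)))"
    using sum_fractions_by_denominator[OF pos, of "\<lambda>x. K_hat q x * ee (of_int n * x)"]
      sum_K_hat[OF less.prems(1)] less.prems(2)[of q] by simp
  also have "\<dots> = (\<Sum>d | d dvd q. of_real (g_fun K d))"
    using sum_g_fun[OF less.prems(1)] by (metis of_real_sum)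
  finally have *: "(\<Sum>d | d dvd q. ?S d) = (\<Sum>d | d dvd q. of_real (g_fun K d))" .
  have "(\<Sum>d\<in>{d. d dvd q} - {q}. ?S d) = (\<Sum>d\<in>{d. d dvd q} - {q}. of_real (g_fun K d))"
  proof (rule sum.cong[OF refl])
    fix d assume "d \<in> {d. d dvd q} - {q}"
    then have d: "d dvd q" "d < q" using pos by (auto intro: le_neq_implies_less dvd_imp_le)
    show "?S d = of_real (g_fun K d)"
      by (rule less.IH[OF d(2) moduli_dvd[OF less.prems(1) d(1)]])
        (use less.prems(2) d(1) dvd_trans in blast)
  qed
  then show ?case
    using * sum.remove[OF fin, of q ?S] sum.remove[OF fin, of q "\<lambda>d. complex_of_real (g_fun K d)"]
    by simp
qed

text \<open>Writing the conjugate coefficient as an average of \<open>ee (of_int k * x)\<close> over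
  \<open>k \<in> K q\<close> turns the energy into an average of \<open>sum_K_hat_primitive\<close>,
  whose value is the same at every \<open>k\<close>.\<close>

lemma sum_norm_K_hat:
  assumes q: "q \<in> moduli Q"
  shows "(\<Sum>a\<in>totatives q. (cmod (K_hat q (real a / real q)))\<^sup>2) = g_fun K q"
proof -
  have c: "complex_of_real ((cmod (K_hat q x))\<^sup>2) = (\<Sum>k\<in>K q. K_hat q x * ee (of_int k * x)) / of_nat (card (K q))" for x
  proof -
    have "cnj (K_hat q x) = (\<Sum>k\<in>K q. ee (of_int k * x)) / of_nat (card (K q))"
      by (simp add: K_hat_def cnj_ee)
    then show ?thesis unfolding complex_norm_square by (simp add: sum_distrib_left)
  qed
  have "complex_of_real (\<Sum>a\<in>totatives q. (cmod (K_hat q (real a / real q)))\<^sup>2)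
      = (\<Sum>a\<in>totatives q. \<Sum>k\<in>K q. K_hat q (real a / real q) * ee (of_int k * (real a / real q))) / of_nat (card (K q))"
    by (simp only: of_real_sum c sum_divide_distrib)
  also have "\<dots> = (\<Sum>k\<in>K q. of_real (g_fun K q)) / of_nat (card (K q))"
    by (subst sum.swap, intro arg_cong2[where f = "(/)"] sum.cong refl)
      (rule sum_K_hat_primitive[OF q K_mod[OF q]])
  also have "\<dots> = of_real (g_fun K q)" using card_K_pos[OF q] by simp
  finally show ?thesis using of_real_eq_iff by blast
qed

lemma g_fun_nonneg: "q \<in> moduli Q \<Longrightarrow> 0 \<le> g_fun K q"
  using sum_norm_K_hat[of q] by (metis (no_types, lifting) sum_nonneg zero_le_power2)

text \<open>On the support of \<open>u\<close> the constant \<open>g_fun K q\<close> is replaced by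
  the primitive Fourier sum. Cauchy-Schwarz then brings in the energy of \<open>K_hat\<close>, which
  is \<open>g_fun K q\<close> again, so one factor cancels.\<close>

lemma g_fun_sum_le:
  assumes q: "q \<in> moduli Q"
    and supp: "\<And>n d. n \<in> I \<Longrightarrow> u n \<noteq> 0 \<Longrightarrow> d dvd q \<Longrightarrow> n mod int d \<in> K d"
  shows "g_fun K q * (\<Sum>n\<in>I. u n)\<^sup>2
    \<le> (\<Sum>a\<in>totatives q. (cmod (\<Sum>n\<in>I. of_real (u n) * ee (of_int n * (real a / real q))))\<^sup>2)"
    (is "_ \<le> (\<Sum>a\<in>_. (cmod (?U a))\<^sup>2)")
proof -
  have "of_real (g_fun K q * (\<Sum>n\<in>I. u n)) = (\<Sum>n\<in>I. of_real (u n) * of_real (g_fun K q) :: complex)"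
    by (simp add: sum_distrib_left mult.commute)
  also have "\<dots> = (\<Sum>n\<in>I. of_real (u n) * (\<Sum>a\<in>totatives q. K_hat q (real a / real q) * ee (of_int n * (real a / real q))))"
  proof (rule sum.cong[OF refl])
    fix n assume "n \<in> I"
    then show "of_real (u n) * complex_of_real (g_fun K q)
      = of_real (u n) * (\<Sum>a\<in>totatives q. K_hat q (real a / real q) * ee (of_int n * (real a / real q)))"
      using sum_K_hat_primitive[OF q, of n] supp[of n] by (cases "u n = 0") auto
  qed
  also have "\<dots> = (\<Sum>a\<in>totatives q. K_hat q (real a / real q) * ?U a)"
    unfolding sum_distrib_left by (subst sum.swap) (simp add: mult_ac)
  finally have "\<bar>g_fun K q * (\<Sum>n\<in>I. u n)\<bar> = cmod (\<Sum>a\<in>totatives q. K_hat q (real a / real q) * ?U a)"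
    by (metis norm_of_real)
  also have "\<dots> \<le> (\<Sum>a\<in>totatives q. cmod (K_hat q (real a / real q)) * cmod (?U a))"
    by (rule sum_norm_le) (simp add: norm_mult)
  finally have "(g_fun K q * (\<Sum>n\<in>I. u n))\<^sup>2 \<le> (\<Sum>a\<in>totatives q. cmod (K_hat q (real a / real q)) * cmod (?U a))\<^sup>2"
    by (rule abs_le_square_iff[THEN iffD1, OF order_trans]) simp
  also have "\<dots> \<le> (\<Sum>a\<in>totatives q. (cmod (K_hat q (real a / real q)))\<^sup>2) * (\<Sum>a\<in>totatives q. (cmod (?U a))\<^sup>2)"
    by (rule Cauchy_Schwarz_ineq_sum)
  finally have *: "g_fun K q * (g_fun K q * (\<Sum>n\<in>I. u n)\<^sup>2) \<le> g_fun K q * (\<Sum>a\<in>totatives q. (cmod (?U a))\<^sup>2)"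
    by (simp only: sum_norm_K_hat[OF q] power_mult_distrib power2_eq_square[of "g_fun K q"] mult.assoc)
  show ?thesis
  proof (cases "g_fun K q = 0")
    case True then show ?thesis by (simp add: sum_nonneg)
  next
    case False
    then show ?thesis using * g_fun_nonneg[OF q] by simp
  qed
qed

end

section \<open>A large sieve inequality with Farey weights\<close>

definition dirichlet_sum :: "nat \<Rightarrow> real \<Rightarrow> complex" where
  "dirichlet_sum L x = (\<Sum>j<L. ee (real j * x))"

lemma dirichlet_sum_add_Ints: "k \<in> \<int> \<Longrightarrow> dirichlet_sum L (x + k) = dirichlet_sum L x"
  unfolding dirichlet_sum_def
  by (intro sum.cong refl) (simp add: distrib_left ee_add_Ints)

lemma norm_dirichlet_sum_le: "cmod (dirichlet_sum L x) \<le> real L"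
  using norm_sum[of "\<lambda>j. ee (real j * x)" "{..<L}"] by (simp add: dirichlet_sum_def)

text \<open>\<open>cmod (ee x - 1)\<close> is \<open>2 * \<bar>sin (pi * x)\<bar>\<close>, and
  concavity keeps sine above its chord on \<open>[0, pi/2]\<close>.\<close>

lemma norm_ee_minus_1_ge:
  assumes "\<bar>x\<bar> \<le> 1/2"
  shows "4 * \<bar>x\<bar> \<le> cmod (ee x - 1)"
proof -
  have main: "2 * x \<le> sin (pi * x)" if x: "0 \<le> x" "x \<le> 1/2" for x
  proof -
    have "convex_on {0..pi/2} (\<lambda>x. - sin x)"
    proof (rule f''_ge0_imp_convex)
      fix x assume "x \<in> {0..pi/2}"
      then show "0 \<le> sin x" by (intro sin_ge_zero) (auto intro: order_trans)
    qed (auto intro!: derivative_eq_intros)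
    from convex_onD[OF this, of "2 * x" 0 "pi/2"] x show ?thesis by (simp add: mult_ac)
  qed
  have "2 * \<bar>x\<bar> \<le> sin (pi * \<bar>x\<bar>)" using main[of "\<bar>x\<bar>"] assms by simp
  also have "\<dots> \<le> \<bar>sin (pi * x)\<bar>" by (cases "0 \<le> x") auto
  also have "2 * \<bar>sin (pi * x)\<bar> = cmod (ee x - 1)"
    using dist_exp_i_1[of "2 * pi * x"] by (simp add: ee_def cis_conv_exp)
  then have "\<bar>sin (pi * x)\<bar> = cmod (ee x - 1) / 2" by simp
  finally show ?thesis by simp
qed

text \<open>The branches of \<open>envelope\<close> are the trivial bound \<open>L\<close> and the
  geometric sum bound \<open>1 / (2 * \<bar>x\<bar>)\<close>, which meet at
  \<open>\<bar>L * x\<bar> = 1/2\<close>.\<close>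

lemma norm_dirichlet_sum_sq_le:
  assumes x: "\<bar>x\<bar> \<le> 1/2"
  shows "(cmod (dirichlet_sum L x))\<^sup>2 \<le> (real L)\<^sup>2 * envelope (real L * x)"
proof (cases "\<bar>real L * x\<bar> \<le> 1/2")
  case True
  then show ?thesis using norm_dirichlet_sum_le by (simp add: envelope_def power_mono)
next
  case False
  then have x0: "x \<noteq> 0" "L \<noteq> 0" by (intro notI; simp)+
  have "dirichlet_sum L x * (ee x - 1) = ee x ^ L - 1"
    by (simp only: dirichlet_sum_def ee_of_nat_mult power_diff_1_eq mult.commute[of _ "ee x - 1"])
  then have "cmod (dirichlet_sum L x) * cmod (ee x - 1) = cmod (ee x ^ L - 1)"
    by (metis norm_mult)
  also have "\<dots> \<le> 2"
    using norm_triangle_ineq4[of "ee x ^ L" 1] by (simp add: norm_power)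
  finally have "cmod (dirichlet_sum L x) * (4 * \<bar>x\<bar>) \<le> 2"
    using norm_ee_minus_1_ge[OF x] by (smt (verit) mult_left_mono norm_ge_zero)
  then have "cmod (dirichlet_sum L x) \<le> 1 / (2 * \<bar>x\<bar>)" using x0 by (simp add: field_simps)
  then have "(cmod (dirichlet_sum L x))\<^sup>2 \<le> (1 / (2 * \<bar>x\<bar>))\<^sup>2" by (intro power_mono) auto
  also have "\<dots> = (real L)\<^sup>2 * envelope (real L * x)"
    using False x0 by (simp add: envelope_def power_divide power_mult_distrib)
  finally show ?thesis .
qed

text \<open>Arcs on the circle are represented by centres in \<open>[-1/2, 1/2]\<close>; with radii
  at most 1/2 they all lie in \<open>[-1, 1]\<close>.\<close>

locale separated_arcs =
  fixes I :: "'i set" and y r :: "'i \<Rightarrow> real"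
  assumes finite_I: "finite I"
    and r_pos: "i \<in> I \<Longrightarrow> 0 < r i" and r_le: "i \<in> I \<Longrightarrow> r i \<le> 1/2"
    and y_le: "i \<in> I \<Longrightarrow> \<bar>y i\<bar> \<le> 1/2"
    and separated: "i \<in> I \<Longrightarrow> j \<in> I \<Longrightarrow> i \<noteq> j \<Longrightarrow> r i + r j \<le> \<bar>y i - y j\<bar>"
begin

lemma increments_le:
  fixes H :: "real \<Rightarrow> real"
  assumes "mono H"
  shows "(\<Sum>i\<in>I. H (y i + r i) - H (y i - r i)) \<le> H 1 - H (- 1)"
proof (rule sum_increments_le)
  fix i assume "i \<in> I"
  then show "- 1 \<le> y i - r i \<and> y i + r i \<le> 1" using r_le[of i] y_le[of i] by linarith
qed (use assms finite_I r_pos separated in auto)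

lemma sum_radius_le: "(\<Sum>i\<in>I. r i) \<le> 1"
  using increments_le[of "\<lambda>x. x"] by (simp add: mono_def sum_distrib_left[symmetric])

text \<open>The saving of \<open>1/4\<close> is the mass outside \<open>[-1, 1]\<close>, which no arc can reach; it pays for the
  passage to a non-integral length in \<open>sum_fejer_mix_le\<close>.\<close>

lemma sum_fejer_le:
  assumes "1 \<le> L"
  shows "(\<Sum>i\<in>I. r i / (1 + real L * r i) * (cmod (dirichlet_sum L (y i)))\<^sup>2) \<le> real L - 1/4"
proof -
  let ?H = "\<lambda>t. real L * mass (real L * t)"
  have "r i / (1 + real L * r i) * (cmod (dirichlet_sum L (y i)))\<^sup>2 \<le> ?H (y i + r i) - ?H (y i - r i)"
    if "i \<in> I" for i
  proof -
    have "r i / (1 + real L * r i) * (cmod (dirichlet_sum L (y i)))\<^sup>2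
        \<le> r i / (1 + real L * r i) * ((real L)\<^sup>2 * envelope (real L * y i))"
      using norm_dirichlet_sum_sq_le[OF y_le[OF that]] r_pos[OF that] by (intro mult_left_mono) auto
    also have "\<dots> = real L * (real L * r i / (1 + real L * r i) * envelope (real L * y i))"
      by (simp add: power2_eq_square)
    also have "\<dots> \<le> real L * (mass (real L * y i + real L * r i) - mass (real L * y i - real L * r i))"
      using assms r_pos[OF that] by (intro mult_left_mono mass_increment_ge) auto
    finally show ?thesis by (simp add: algebra_simps)
  qed
  then have "(\<Sum>i\<in>I. r i / (1 + real L * r i) * (cmod (dirichlet_sum L (y i)))\<^sup>2)
      \<le> (\<Sum>i\<in>I. ?H (y i + r i) - ?H (y i - r i))"
    by (rule sum_mono)
  also have "\<dots> \<le> ?H 1 - ?H (- 1)"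
    by (rule increments_le) (auto intro!: monoI mult_left_mono monoD[OF mono_mass])
  \<comment> \<open>\<open>1 \<le> L\<close> puts the endpoint on the tail branch, where
    \<open>2 * L * mass L = L - 1/4\<close>.\<close>
  also have "\<dots> = real L - 1/4"
    using assms by (simp add: mass_minus mass_right field_simps)
  finally show ?thesis .
qed

end

text \<open>The kernel with coefficients \<open>max 0 (l - \<bar>h\<bar>)\<close> (see \<open>fejer_mix_eq\<close>): at the integers this tent
  is the linear interpolation between the tents of the two integers surrounding \<open>l\<close>.\<close>

definition fejer_mix :: "real \<Rightarrow> real \<Rightarrow> real" where
  "fejer_mix l x = (1 - frac l) * (cmod (dirichlet_sum (nat \<lfloor>l\<rfloor>) x))\<^sup>2
     + frac l * (cmod (dirichlet_sum (Suc (nat \<lfloor>l\<rfloor>)) x))\<^sup>2"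

lemma fejer_mix_add_Ints: "k \<in> \<int> \<Longrightarrow> fejer_mix l (x + k) = fejer_mix l x"
  by (simp add: fejer_mix_def dirichlet_sum_add_Ints)

text \<open>Replacing \<open>l\<close> in the weight by the integer below it only increases the
  weight; replacing it by the integer above costs a factor \<open>c\<close>. The resulting extra
  term is at most 1/4, the amount that \<open>sum_fejer_le\<close> saves.\<close>

lemma (in separated_arcs) sum_fejer_mix_le:
  assumes l: "0 < l"
  shows "(\<Sum>i\<in>I. r i / (1 + l * r i) * fejer_mix l (y i)) \<le> l"
proof -
  define L where "L = nat \<lfloor>l\<rfloor>"
  define f where "f = frac l"
  have f: "0 \<le> f" "f < 1" by (auto simp: f_def frac_lt_1)
  have lLf: "l = real L + f" using l by (simp add: L_def f_def frac_def)
  show ?thesis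
  proof (cases "L = 0")
    case True
    \<comment> \<open>At \<open>L = 0\<close> the estimate \<open>sum_fejer_le\<close> does not
      apply, but the mixed kernel is the constant \<open>f = l\<close> and the total radius is at
      most 1.\<close>
    have "r i / (1 + l * r i) * fejer_mix l (y i) \<le> f * r i" if "i \<in> I" for i
    proof -
      have "fejer_mix l (y i) = f"
        using True by (simp add: fejer_mix_def L_def[symmetric] f_def[symmetric] dirichlet_sum_def)
      moreover have "r i / (1 + l * r i) \<le> r i" using r_pos[OF that] l
        by (simp add: pos_divide_le_eq add_pos_pos algebra_simps)
      ultimately show ?thesis using f mult_right_mono[of "r i / (1 + l * r i)" "r i" f] by (simp add: mult.commute)
    qed
    then have "(\<Sum>i\<in>I. r i / (1 + l * r i) * fejer_mix l (y i)) \<le> (\<Sum>i\<in>I. f * r i)" by (rule sum_mono)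
    also have "\<dots> \<le> f * 1" using sum_radius_le f unfolding sum_distrib_left[symmetric] by (intro mult_left_mono)
    finally show ?thesis using lLf True by simp
  next
    case False
    let ?A = "\<lambda>L i. r i / (1 + real L * r i) * (cmod (dirichlet_sum L (y i)))\<^sup>2"
    \<comment> \<open>As \<open>Suc L - l = 1 - f\<close>, the ratio of \<open>1 + Suc L * r\<close>
      to \<open>1 + l * r\<close> is \<open>1 + (1 - f) * r / (1 + l * r)\<close>, and
      \<open>r \<le> 1/2\<close> bounds this by \<open>c\<close>.\<close>
    define c where "c = 1 + (1 - f) / (l + 2)"
    have "r i / (1 + l * r i) * fejer_mix l (y i) \<le> (1 - f) * ?A L i + f * c * ?A (Suc L) i"
      if i: "i \<in> I" for i
    proof -
      note r = r_pos[OF i] r_le[OF i]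
      have d: "0 < 1 + l * r i" "0 < 1 + real L * r i" "0 < 1 + real (Suc L) * r i"
        using l r by (auto intro!: add_pos_nonneg)
      have 1: "r i / (1 + l * r i) \<le> r i / (1 + real L * r i)"
        using r f d by (intro divide_left_mono mult_pos_pos) (auto simp: lLf)
      have "(1 - f) * r i * (l + 2) \<le> (1 - f) * (1 + l * r i)"
      proof -
        have "r i * (l + 2) \<le> 1 + l * r i" using r by (simp add: algebra_simps)
        then show ?thesis using f by (simp add: mult.assoc mult_left_mono)
      qed
      then have "(1 - f) * r i \<le> (1 - f) / (l + 2) * (1 + l * r i)"
        using l by (simp add: field_simps)
      then have "1 + real (Suc L) * r i \<le> c * (1 + l * r i)"
        by (simp add: c_def lLf algebra_simps)
      then have 2: "r i / (1 + l * r i) \<le> c * (r i / (1 + real (Suc L) * r i))"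
        using d r by (simp add: divide_simps)
      have "r i / (1 + l * r i) * fejer_mix l (y i)
          = (1 - f) * (r i / (1 + l * r i) * (cmod (dirichlet_sum L (y i)))\<^sup>2)
            + f * (r i / (1 + l * r i) * (cmod (dirichlet_sum (Suc L) (y i)))\<^sup>2)"
        by (simp add: fejer_mix_def L_def f_def distrib_left mult_ac)
      also have "\<dots> \<le> (1 - f) * (r i / (1 + real L * r i) * (cmod (dirichlet_sum L (y i)))\<^sup>2)
            + f * (c * (r i / (1 + real (Suc L) * r i)) * (cmod (dirichlet_sum (Suc L) (y i)))\<^sup>2)"
        using f 1 2 by (intro add_mono mult_left_mono mult_right_mono) auto
      finally show ?thesis by (simp only: mult.assoc)
    qed
    then have "(\<Sum>i\<in>I. r i / (1 + l * r i) * fejer_mix l (y i))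
        \<le> (\<Sum>i\<in>I. (1 - f) * ?A L i + f * c * ?A (Suc L) i)"
      by (rule sum_mono)
    also have "\<dots> = (1 - f) * (\<Sum>i\<in>I. ?A L i) + f * c * (\<Sum>i\<in>I. ?A (Suc L) i)"
      by (simp only: sum.distrib sum_distrib_left)
    also have "\<dots> \<le> (1 - f) * (real L - 1/4) + f * c * (real (Suc L) - 1/4)"
      using f False l sum_fejer_le[of L] sum_fejer_le[of "Suc L"]
      by (intro add_mono mult_left_mono) (auto simp: c_def)
    also have "\<dots> = l - 1/4 + f * (1 - f) * ((real L + 3/4) / (l + 2))"
    proof -
      have "(1 - f) * (real L - 1/4) + f * (1 + t) * (real (Suc L) - 1/4)
          = real L + f - 1/4 + f * t * (real L + 3/4)" for t
        by (simp add: field_simps)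
      then show ?thesis by (simp add: c_def lLf[symmetric])
    qed
    also have "\<dots> \<le> l"
    proof -
      have "f * (1 - f) = 1/4 - (f - 1/2)\<^sup>2" by (simp add: power2_eq_square algebra_simps)
      then have "f * (1 - f) \<le> 1/4" by simp
      moreover have "(real L + 3/4) / (l + 2) \<le> 1" using f lLf l by (simp add: field_simps)
      ultimately have "f * (1 - f) * ((real L + 3/4) / (l + 2)) \<le> 1/4 * 1"
        using l by (intro mult_mono) auto
      then show ?thesis by simp
    qed
    finally show ?thesis .
  qed
qed

text \<open>A lower bound for the distance of a reduced fraction with denominator \<open>q\<close> to the endpoints of
  its Farey arc of order \<open>Q\<close>.\<close>

definition arc_radius :: "real \<Rightarrow> nat \<Rightarrow> real" where
  "arc_radius Q q = 1 / (real q * (real q + Q))"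

text \<open>Clearing denominators leaves \<open>a * a + b * b \<le> a * b + Q * Q\<close>: the
  smaller square is at most \<open>a * b\<close>, the larger at most \<open>Q * Q\<close>.\<close>

lemma arc_radius_add_le:
  assumes q: "q \<in> moduli Q" and q': "q' \<in> moduli Q"
  shows "arc_radius Q q + arc_radius Q q' \<le> 1 / (real q * real q')"
proof -
  define a b where "a = real q" and "b = real q'"
  have ab: "0 < a" "a \<le> Q" "0 < b" "b \<le> Q" using q q' by (auto simp: moduli_def a_def b_def)
  have "a * a + b * b \<le> a * b + Q * Q"
  proof (cases "a \<le> b")
    case True
    then have "a * a \<le> a * b" "b * b \<le> Q * Q" using ab by (auto intro!: mult_mono)
    then show ?thesis by simp
  next
    case False
    then have "b * b \<le> a * b" "a * a \<le> Q * Q" using ab by (auto intro!: mult_mono)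
    then show ?thesis by simp
  qed
  then have *: "b * (b + Q) + a * (a + Q) \<le> (a + Q) * (b + Q)" by (simp add: algebra_simps)
  have "1 / (a * A) + 1 / (b * B) = (b * B + a * A) / (a * b * (A * B))" if "0 < A" "0 < B" for A B
    using ab that by (simp add: field_simps)
  from this[of "a + Q" "b + Q"]
  have "1 / (a * (a + Q)) + 1 / (b * (b + Q)) = (b * (b + Q) + a * (a + Q)) / (a * b * ((a + Q) * (b + Q)))"
    using ab by simp
  also have "\<dots> \<le> ((a + Q) * (b + Q)) / (a * b * ((a + Q) * (b + Q)))"
    using * ab by (intro divide_right_mono) auto
  also have "\<dots> = 1 / (a * b)" using ab by simp
  finally show ?thesis by (simp add: arc_radius_def a_def b_def)
qed

text \<open>The difference is an integer over \<open>q * q'\<close>, so only a zero numerator has to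
  be excluded. It would force \<open>q = q'\<close> by coprimality, and then \<open>a\<close> and
  \<open>a'\<close>, congruent and both in \<open>{0<..q}\<close>, would coincide. Allowing every
  \<open>k\<close> makes this a separation modulo 1.\<close>

lemma fractions_separated:
  assumes "0 < q" "0 < q'" "a \<in> totatives q" "a' \<in> totatives q'" "(q, a) \<noteq> (q', a')"
  shows "1 / (real q * real q') \<le> \<bar>real a / real q - real a' / real q' - of_int k\<bar>"
proof -
  define n where "n = int a * int q' - int a' * int q - k * int q * int q'"
  have "n \<noteq> 0"
  proof
    assume "n = 0"
    then have e: "int a * int q' = int a' * int q + k * int q * int q'" by (simp add: n_def)
    have "int q dvd int a * int q'" unfolding e by simp
    moreover have "int q' dvd int a' * int q"
      using e by (metis dvd_add_left_iff dvd_triv_right)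
    ultimately have "q dvd q'" "q' dvd q"
      using assms(3,4) by (auto simp: in_totatives_iff coprime_commute coprime_dvd_mult_right_iff
          simp flip: of_nat_mult)
    then have qq: "q = q'" by (rule dvd_antisym)
    with e assms(1) have "int a = int a' + k * int q" by (simp add: distrib_right[symmetric])
    moreover have "0 < a" "a \<le> q" "0 < a'" "a' \<le> q"
      using assms(3,4) qq by (auto simp: in_totatives_iff)
    moreover have "k = 0"
    proof (rule ccontr)
      assume "k \<noteq> 0"
      then consider "1 \<le> k" | "k \<le> - 1" by linarith
      then have "int q \<le> k * int q \<or> k * int q \<le> - int q"
        using mult_right_mono[of 1 k "int q"] mult_right_mono[of k "-1" "int q"] by cases auto
      then show False using calculation by linarith
    qed
    ultimately have "a = a'" by simp
    then show False using assms(5) qq by simp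
  qed
  then have "1 \<le> \<bar>real_of_int n\<bar>" by linarith
  moreover have "real a / real q - real a' / real q' - of_int k = real_of_int n / (real q * real q')"
    using assms(1,2) by (simp add: n_def field_simps)
  ultimately show ?thesis using assms(1,2) by (simp add: abs_mult divide_right_mono)
qed

lemma finite_moduli: "finite (moduli Q)"
proof (rule finite_subset)
  show "moduli Q \<subseteq> {..nat \<lfloor>Q\<rfloor>}" by (auto simp: moduli_def le_nat_floor)
qed simp

text \<open>With \<open>r = arc_radius Q q\<close> the weight is \<open>r / (1 + l * r)\<close>, as
  in \<open>sum_fejer_mix_le\<close>. Subtracting the nearest integer brings the centres into
  \<open>[-1/2, 1/2]\<close> and leaves the 1-periodic kernel unchanged.\<close>

lemma sum_fejer_mix_fractions_le:
  assumes "1 \<le> Q" "0 < l"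
  shows "(\<Sum>q\<in>moduli Q. \<Sum>a\<in>totatives q.
    fejer_mix l (real a / real q - x) / (l + real q * (real q + Q))) \<le> l"
proof -
  define I where "I = (SIGMA q:moduli Q. totatives q)"
  define y where "y = (\<lambda>(q, a). real a / real q - x - of_int (round (real a / real q - x)))"
  define r :: "nat \<times> nat \<Rightarrow> real" where "r = (\<lambda>(q, a). arc_radius Q q)"
  have mod: "0 < q" "1 \<le> real q" "real q \<le> Q" if "q \<in> moduli Q" for q
    using that by (auto simp: moduli_def)
  interpret separated_arcs I y r
  proof
    show "finite I" unfolding I_def using finite_moduli by (intro finite_SigmaI) auto
    fix i assume "i \<in> I"
    then obtain q a where i: "i = (q, a)" "q \<in> moduli Q" "a \<in> totatives q" by (auto simp: I_def)
    note m = mod[OF i(2)]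
    show "0 < r i" using m by (simp add: r_def i(1) arc_radius_def)
    have "1 * 2 \<le> real q * (real q + Q)" using m assms by (intro mult_mono) auto
    then show "r i \<le> 1/2" by (simp add: r_def i(1) arc_radius_def field_simps)
    show "\<bar>y i\<bar> \<le> 1/2"
      using of_int_round_abs_le[of "real a / real q - x"] by (simp add: y_def i(1) abs_minus_commute)
    fix j assume "j \<in> I" "i \<noteq> j"
    then obtain q' a' where j: "j = (q', a')" "q' \<in> moduli Q" "a' \<in> totatives q'" by (auto simp: I_def)
    have "r i + r j \<le> 1 / (real q * real q')"
      using arc_radius_add_le[OF i(2) j(2)] by (simp add: r_def i(1) j(1))
    also have "\<dots> \<le> \<bar>real a / real q - real a' / real q'
        - of_int (round (real a / real q - x) - round (real a' / real q' - x))\<bar>"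
      using i j \<open>i \<noteq> j\<close> mod by (intro fractions_separated) auto
    also have "\<dots> = \<bar>y i - y j\<bar>" by (simp add: y_def i(1) j(1) algebra_simps)
    finally show "r i + r j \<le> \<bar>y i - y j\<bar>" .
  qed
  have "(\<Sum>q\<in>moduli Q. \<Sum>a\<in>totatives q. fejer_mix l (real a / real q - x) / (l + real q * (real q + Q)))
      = (\<Sum>(q, a)\<in>I. fejer_mix l (real a / real q - x) / (l + real q * (real q + Q)))"
    unfolding I_def using finite_moduli by (intro sum.Sigma) auto
  also have "\<dots> = (\<Sum>i\<in>I. r i / (1 + l * r i) * fejer_mix l (y i))"
  proof (rule sum.cong[OF refl])
    fix i assume "i \<in> I"
    then obtain q a where i: "i = (q, a)" "q \<in> moduli Q" by (auto simp: I_def)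
    note m = mod[OF i(2)]
    have p: "0 < real q * (real q + Q)" using m by simp
    have "r i / (1 + l * r i) = 1 / (l + real q * (real q + Q))"
    proof -
      have "1 / c / (1 + l * (1 / c)) = 1 / (l + c)" if "0 < c" for c
        using that assms(2) by (simp add: field_simps)
      from this[OF p] show ?thesis by (simp add: r_def i(1) arc_radius_def)
    qed
    moreover have "fejer_mix l (y i) = fejer_mix l (real a / real q - x)"
      using fejer_mix_add_Ints[of "- of_int (round (real a / real q - x))" l "real a / real q - x"]
      by (simp add: y_def i(1))
    ultimately show "(case i of (q, a) \<Rightarrow> fejer_mix l (real a / real q - x) / (l + real q * (real q + Q)))
        = r i / (1 + l * r i) * fejer_mix l (y i)" by (simp add: i(1))
  qed
  also have "\<dots> \<le> l" using assms(2) by (rule sum_fejer_mix_le)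
  finally show ?thesis .
qed

section \<open>Fourier expansion of the kernel and averaging over frequencies\<close>

lemma card_pairs_with_difference:
  "card {(i, j). i < L \<and> j < L \<and> int i - int j = h} = nat (int L - \<bar>h\<bar>)"
proof (cases h rule: int_cases2)
  case (nonneg k)
  have "{(i, j). i < L \<and> j < L \<and> int i - int j = h} = (\<lambda>j. (j + k, j)) ` {..<L - k}"
    unfolding nonneg by (auto simp: image_iff)
  moreover have "nat (int L - \<bar>h\<bar>) = L - k" unfolding nonneg by simp
  ultimately show ?thesis by (simp add: card_image inj_on_def)
next
  case (nonpos k)
  have "{(i, j). i < L \<and> j < L \<and> int i - int j = h} = (\<lambda>j. (j, j + k)) ` {..<L - k}"
    unfolding nonpos by (auto simp: image_iff)
  moreover have "nat (int L - \<bar>h\<bar>) = L - k" unfolding nonpos by simp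
  ultimately show ?thesis by (simp add: card_image inj_on_def)
qed

text \<open>The coefficient of \<open>h\<close> counts pairs with difference \<open>h\<close>. The
  separate cutoff \<open>H\<close> lets the lengths \<open>L\<close> and \<open>Suc L\<close> be
  expanded over the same frequencies.\<close>

lemma norm_dirichlet_sum_sq_eq:
  assumes "L \<le> Suc H"
  shows "complex_of_real ((cmod (dirichlet_sum L x))\<^sup>2)
    = (\<Sum>h\<in>{- int H..int H}. of_real (max 0 (real L - \<bar>of_int h\<bar>)) * ee (of_int h * x))"
proof -
  let ?P = "{..<L} \<times> {..<L}"
  have "complex_of_real ((cmod (dirichlet_sum L x))\<^sup>2) = (\<Sum>i<L. \<Sum>j<L. ee (real i * x - real j * x))"
    using cmod_sum_sq[of "\<lambda>_. 1" "\<lambda>j. real j * x" "{..<L}"] by (simp add: dirichlet_sum_def)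
  also have "\<dots> = (\<Sum>p\<in>?P. ee (of_int (int (fst p) - int (snd p)) * x))"
    by (simp add: sum.cartesian_product case_prod_beta left_diff_distrib)
  also have "\<dots> = (\<Sum>h\<in>{- int H..int H}. \<Sum>p\<in>{p \<in> ?P. int (fst p) - int (snd p) = h}. ee (of_int (int (fst p) - int (snd p)) * x))"
    using assms by (intro sum.group[symmetric]) auto
  also have "\<dots> = (\<Sum>h\<in>{- int H..int H}. of_real (max 0 (real L - \<bar>of_int h\<bar>)) * ee (of_int h * x))"
  proof (rule sum.cong[OF refl])
    fix h
    have "{p \<in> ?P. int (fst p) - int (snd p) = h} = {(i, j). i < L \<and> j < L \<and> int i - int j = h}" by auto
    then have c: "card {p \<in> ?P. int (fst p) - int (snd p) = h} = nat (int L - \<bar>h\<bar>)"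
      by (simp only: card_pairs_with_difference)
    have "(\<Sum>p\<in>{p \<in> ?P. int (fst p) - int (snd p) = h}. ee (of_int (int (fst p) - int (snd p)) * x))
      = (\<Sum>p\<in>{p \<in> ?P. int (fst p) - int (snd p) = h}. ee (of_int h * x))"
      by (rule sum.cong) auto
    also have "\<dots> = of_nat (nat (int L - \<bar>h\<bar>)) * ee (of_int h * x)"
      by (simp only: sum_constant c)
    also have "of_nat (nat (int L - \<bar>h\<bar>)) = complex_of_real (max 0 (real L - \<bar>of_int h\<bar>))"
    proof -
      have "real (nat (int L - \<bar>h\<bar>)) = max 0 (real L - \<bar>of_int h\<bar>)" by linarith
      then show ?thesis by (metis of_real_of_nat_eq)
    qed
    finally show "(\<Sum>p\<in>{p \<in> ?P. int (fst p) - int (snd p) = h}. ee (of_int (int (fst p) - int (snd p)) * x))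
      = of_real (max 0 (real L - \<bar>of_int h\<bar>)) * ee (of_int h * x)" .
  qed
  finally show ?thesis .
qed

lemma fejer_mix_eq:
  assumes l: "0 < l"
  shows "complex_of_real (fejer_mix l x)
    = (\<Sum>h\<in>{- \<lfloor>l\<rfloor>..\<lfloor>l\<rfloor>}. of_real (max 0 (l - \<bar>of_int h\<bar>)) * ee (of_int h * x))"
proof -
  define L where "L = nat \<lfloor>l\<rfloor>"
  define f where "f = frac l"
  have lLf: "l = real L + f" and fl: "\<lfloor>l\<rfloor> = int L" using l by (auto simp: L_def f_def frac_def)
  have coef: "(1 - f) * max 0 (real L - \<bar>of_int h\<bar>) + f * max 0 (real (Suc L) - \<bar>of_int h\<bar>) = max 0 (l - \<bar>of_int h\<bar>)"
    if "h \<in> {- int L..int L}" for h :: int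
  proof -
    have "\<bar>real_of_int h\<bar> \<le> real L" using that by auto
    moreover have "0 \<le> f" by (simp add: f_def)
    ultimately have "max 0 (real L - \<bar>of_int h\<bar>) = real L - \<bar>of_int h\<bar>"
      "max 0 (real (Suc L) - \<bar>of_int h\<bar>) = real L + 1 - \<bar>of_int h\<bar>"
      "max 0 (l - \<bar>of_int h\<bar>) = real L + f - \<bar>of_int h\<bar>"
      unfolding lLf by simp_all
    then show ?thesis by (simp add: algebra_simps)
  qed
  have "complex_of_real (fejer_mix l x)
      = of_real (1 - f) * of_real ((cmod (dirichlet_sum L x))\<^sup>2) + of_real f * of_real ((cmod (dirichlet_sum (Suc L) x))\<^sup>2)"
    by (simp add: fejer_mix_def L_def f_def)
  also have "\<dots> = (\<Sum>h\<in>{- int L..int L}. of_real ((1 - f) * max 0 (real L - \<bar>of_int h\<bar>) + f * max 0 (real (Suc L) - \<bar>of_int h\<bar>)) * ee (of_int h * x))"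
    unfolding norm_dirichlet_sum_sq_eq[of L L x, OF le_SucI[OF order_refl]] norm_dirichlet_sum_sq_eq[of "Suc L" L x, OF order_refl]
    by (simp only: sum_distrib_left sum.distrib[symmetric] of_real_add of_real_mult distrib_right mult.assoc)
  also have "\<dots> = (\<Sum>h\<in>{- \<lfloor>l\<rfloor>..\<lfloor>l\<rfloor>}. of_real (max 0 (l - \<bar>of_int h\<bar>)) * ee (of_int h * x))"
    unfolding fl by (intro sum.cong refl) (simp only: coef)
  finally show ?thesis .
qed

lemma int_dvd_iff_small: "\<bar>k\<bar> < int P \<Longrightarrow> int P dvd k \<longleftrightarrow> k = 0"
  using dvd_imp_le_int[of k "int P"] by auto

text \<open>The average over the circle is taken over the grid of points \<open>j / P\<close>. This
  is exact because \<open>P\<close> exceeds every \<open>\<bar>m - n - h\<bar>\<close> that occurs,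
  so orthogonality keeps only \<open>h = m - n\<close>.\<close>

lemma fejer_form_eq_average:
  fixes u :: "int \<Rightarrow> real"
  assumes I: "I \<subseteq> {- int B..int B}" and l: "0 < l" and P: "2 * int B + \<lfloor>l\<rfloor> < int P"
  shows "(\<Sum>m\<in>I. \<Sum>n\<in>I. u m * u n * max 0 (l - \<bar>of_int m - of_int n\<bar>) * cos (2 * pi * ((of_int m - of_int n) * x)))
    = (\<Sum>j\<in>{0<..P}. (cmod (\<Sum>n\<in>I. of_real (u n) * ee (of_int n * (real j / real P))))\<^sup>2
          * fejer_mix l (x - real j / real P)) / real P"
proof -
  have "0 \<le> \<lfloor>l\<rfloor>" using l by simp
  then have P0: "0 < P" using P by linarith
  let ?H = "{- \<lfloor>l\<rfloor>..\<lfloor>l\<rfloor>}"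
  let ?w = "\<lambda>h. of_real (max 0 (l - \<bar>of_int h\<bar>)) :: complex"
  have "complex_of_real (\<Sum>j\<in>{0<..P}. (cmod (\<Sum>n\<in>I. of_real (u n) * ee (of_int n * (real j / real P))))\<^sup>2
          * fejer_mix l (x - real j / real P))
     = (\<Sum>j\<in>{0<..P}. (\<Sum>m\<in>I. \<Sum>n\<in>I. of_real (u m * u n) * ee (of_int m * (real j / real P) - of_int n * (real j / real P)))
          * (\<Sum>h\<in>?H. ?w h * ee (of_int h * (x - real j / real P))))"
    unfolding of_real_sum of_real_mult[of "_\<^sup>2"] cmod_sum_sq fejer_mix_eq[OF l] ..
  also have "\<dots> = (\<Sum>j\<in>{0<..P}. \<Sum>m\<in>I. \<Sum>n\<in>I. \<Sum>h\<in>?H.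
      of_real (u m * u n) * ?w h * ee (of_int h * x) * ee (of_int (m - n - h) * (real j / real P)))"
  proof -
    have "ee (of_int m * t - of_int n * t) * ee (of_int h * (x - t)) = ee (of_int h * x) * ee (of_int (m - n - h) * t)"
      for m n h :: int and t :: real
      by (simp add: ee_add[symmetric] algebra_simps)
    then have eq: "(U * ee (of_int m * t - of_int n * t)) * (W * ee (of_int h * (x - t)))
       = U * W * ee (of_int h * x) * ee (of_int (m - n - h) * t)" for m n h t U W
      by (simp only: mult.assoc mult.left_commute[of _ W])
    show ?thesis unfolding sum_distrib_right unfolding sum_distrib_left by (simp only: eq)
  qed
  also have "\<dots> = (\<Sum>m\<in>I. \<Sum>n\<in>I. \<Sum>h\<in>?H.
      of_real (u m * u n) * ?w h * ee (of_int h * x) * (\<Sum>j\<in>{0<..P}. ee (of_int (m - n - h) * (real j / real P))))"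
    unfolding sum_distrib_left
    by (subst sum.swap, rule sum.cong[OF refl], subst sum.swap, rule sum.cong[OF refl], subst sum.swap, rule refl)
  also have "\<dots> = (\<Sum>m\<in>I. \<Sum>n\<in>I. of_nat P * (of_real (u m * u n) * ?w (m - n) * ee (of_int (m - n) * x)))"
  proof (intro sum.cong refl)
    fix m n assume mn: "m \<in> I" "n \<in> I"
    have "(\<Sum>h\<in>?H. of_real (u m * u n) * ?w h * ee (of_int h * x) * (\<Sum>j\<in>{0<..P}. ee (of_int (m - n - h) * (real j / real P))))
        = (\<Sum>h\<in>?H. if h = m - n then of_nat P * (of_real (u m * u n) * ?w h * ee (of_int h * x)) else 0)"
    proof (rule sum.cong[OF refl])
      fix h assume h: "h \<in> ?H"
      have "m \<in> {- int B..int B}" "n \<in> {- int B..int B}" using mn I by blast+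
      then have "\<bar>m - n - h\<bar> < int P" using h P by auto
      then have "int P dvd m - n - h \<longleftrightarrow> h = m - n"
        by (auto simp: int_dvd_iff_small)
      then show "of_real (u m * u n) * ?w h * ee (of_int h * x) * (\<Sum>j\<in>{0<..P}. ee (of_int (m - n - h) * (real j / real P)))
        = (if h = m - n then of_nat P * (of_real (u m * u n) * ?w h * ee (of_int h * x)) else 0)"
        by (simp only: sum_ee_residues[OF P0]) simp
    qed
    also have "\<dots> = (if m - n \<in> ?H then of_nat P * (of_real (u m * u n) * ?w (m - n) * ee (of_int (m - n) * x)) else 0)"
      by (simp only: sum.delta finite_atLeastAtMost_int)
    also have "\<dots> = of_nat P * (of_real (u m * u n) * ?w (m - n) * ee (of_int (m - n) * x))"
    \<comment> \<open>If \<open>m - n\<close> lies outside the range of \<open>h\<close>, then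
      \<open>\<bar>m - n\<bar>\<close> exceeds \<open>l\<close> and its coefficient is zero
      anyway.\<close>
    proof (cases "m - n \<in> ?H")
      case False
      then have "\<lfloor>l\<rfloor> < \<bar>m - n\<bar>" by auto
      then have "l < of_int \<bar>m - n\<bar>" by (simp add: floor_less_iff)
      then show ?thesis by simp
    qed (simp only: if_True)
    finally show "(\<Sum>h\<in>?H. of_real (u m * u n) * ?w h * ee (of_int h * x) * (\<Sum>j\<in>{0<..P}. ee (of_int (m - n - h) * (real j / real P))))
        = of_nat P * (of_real (u m * u n) * ?w (m - n) * ee (of_int (m - n) * x))" .
  qed
  finally have "(\<Sum>j\<in>{0<..P}. (cmod (\<Sum>n\<in>I. of_real (u n) * ee (of_int n * (real j / real P))))\<^sup>2
          * fejer_mix l (x - real j / real P))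
     = Re (\<Sum>m\<in>I. \<Sum>n\<in>I. of_nat P * (of_real (u m * u n) * ?w (m - n) * ee (of_int (m - n) * x)))"
    by (metis Re_complex_of_real)
  also have "\<dots> = real P * (\<Sum>m\<in>I. \<Sum>n\<in>I. u m * u n * max 0 (l - \<bar>of_int m - of_int n\<bar>) * cos (2 * pi * ((of_int m - of_int n) * x)))"
    by (simp add: ee_def sum_distrib_left mult.assoc)
  finally show ?thesis using P0 by simp
qed

text \<open>Parseval on the grid: all differences are below \<open>P\<close> in absolute value, so
  only the diagonal survives.\<close>

lemma sum_norm_exponential_sum_sq:
  fixes u :: "int \<Rightarrow> real"
  assumes I: "I \<subseteq> {- int B..int B}" and P: "2 * int B < int P"
  shows "(\<Sum>j\<in>{0<..P}. (cmod (\<Sum>n\<in>I. of_real (u n) * ee (of_int n * (real j / real P))))\<^sup>2)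
    = real P * (\<Sum>n\<in>I. (u n)\<^sup>2)"
proof -
  have P0: "0 < P" using P by linarith
  have fin: "finite I" using I finite_subset by blast
  have "complex_of_real (\<Sum>j\<in>{0<..P}. (cmod (\<Sum>n\<in>I. of_real (u n) * ee (of_int n * (real j / real P))))\<^sup>2)
      = (\<Sum>j\<in>{0<..P}. \<Sum>m\<in>I. \<Sum>n\<in>I. of_real (u m * u n) * ee (of_int (m - n) * (real j / real P)))"
    by (simp only: of_real_sum cmod_sum_sq of_int_diff left_diff_distrib)
  also have "\<dots> = (\<Sum>m\<in>I. \<Sum>n\<in>I. of_real (u m * u n) * (\<Sum>j\<in>{0<..P}. ee (of_int (m - n) * (real j / real P))))"
    unfolding sum_distrib_left
    by (subst sum.swap, rule sum.cong[OF refl], subst sum.swap, rule refl)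
  also have "\<dots> = (\<Sum>m\<in>I. \<Sum>n\<in>I. if m = n then of_real (real P * (u n)\<^sup>2) else 0)"
  proof (intro sum.cong refl)
    fix m n assume mn: "m \<in> I" "n \<in> I"
    have "m \<in> {- int B..int B}" "n \<in> {- int B..int B}" using mn I by blast+
    then have "\<bar>m - n\<bar> < int P" using P by auto
    then have "int P dvd m - n \<longleftrightarrow> m = n"
      by (auto simp: int_dvd_iff_small)
    then show "of_real (u m * u n) * (\<Sum>j\<in>{0<..P}. ee (of_int (m - n) * (real j / real P)))
        = (if m = n then of_real (real P * (u n)\<^sup>2) else (0::complex))"
      by (simp only: sum_ee_residues[OF P0]) (simp add: power2_eq_square mult_ac)
  qed
  also have "\<dots> = of_real (real P * (\<Sum>n\<in>I. (u n)\<^sup>2))"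
    using fin by (simp add: sum_distrib_left)
  finally show ?thesis using of_real_eq_iff by blast
qed

text \<open>The quadratic forms become averages of squared moduli against shifted kernels. Since the
  squares are non-negative, \<open>sum_fejer_mix_fractions_le\<close> applies at each grid point,
  and Parseval evaluates what remains.\<close>

lemma weighted_large_sieve:
  fixes u :: "int \<Rightarrow> real"
  assumes Q: "1 \<le> Q" and l: "0 < l" and I: "finite I"
  shows "(\<Sum>q\<in>moduli Q. \<Sum>a\<in>totatives q.
      (\<Sum>m\<in>I. \<Sum>n\<in>I. u m * u n * max 0 (l - \<bar>of_int m - of_int n\<bar>)
          * cos (2 * pi * ((of_int m - of_int n) * (real a / real q)))) / (l + real q * (real q + Q)))
    \<le> l * (\<Sum>n\<in>I. (u n)\<^sup>2)"
proof -
  obtain B :: nat where B: "I \<subseteq> {- int B..int B}"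
  proof
    \<comment> \<open>\<open>insert 0\<close> gives the maximum a value for empty \<open>I\<close>
      too.\<close>
    show "I \<subseteq> {- int (nat (Max (insert 0 (abs ` I))))..int (nat (Max (insert 0 (abs ` I))))}"
    proof
      fix n assume "n \<in> I"
      then have "\<bar>n\<bar> \<le> Max (insert 0 (abs ` I))" using I by (intro Max_ge) auto
      then show "n \<in> {- int (nat (Max (insert 0 (abs ` I))))..int (nat (Max (insert 0 (abs ` I))))}" by auto
    qed
  qed
  define P where "P = nat (2 * int B + \<lfloor>l\<rfloor> + 1)"
  have P: "2 * int B + \<lfloor>l\<rfloor> < int P" using l by (auto simp: P_def)
  moreover have "0 \<le> \<lfloor>l\<rfloor>" using l by simp
  ultimately have P': "2 * int B < int P" and P0: "0 < P" by linarith+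
  let ?U = "\<lambda>j. (cmod (\<Sum>n\<in>I. of_real (u n) * ee (of_int n * (real j / real P))))\<^sup>2"
  let ?w = "\<lambda>q. l + real q * (real q + Q)"
  have "(\<Sum>q\<in>moduli Q. \<Sum>a\<in>totatives q.
      (\<Sum>m\<in>I. \<Sum>n\<in>I. u m * u n * max 0 (l - \<bar>of_int m - of_int n\<bar>)
          * cos (2 * pi * ((of_int m - of_int n) * (real a / real q)))) / ?w q)
    = (\<Sum>q\<in>moduli Q. \<Sum>a\<in>totatives q. \<Sum>j\<in>{0<..P}. ?U j * (fejer_mix l (real a / real q - real j / real P) / ?w q) / real P)"
    unfolding fejer_form_eq_average[OF B l P] sum_divide_distrib by (simp add: mult_ac)
  also have "\<dots> = (\<Sum>j\<in>{0<..P}. ?U j * (\<Sum>q\<in>moduli Q. \<Sum>a\<in>totatives q. fejer_mix l (real a / real q - real j / real P) / ?w q)) / real P"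
    unfolding sum_divide_distrib sum_distrib_left
    by (rule trans[OF sum.cong[OF refl sum.swap] sum.swap])
  also have "\<dots> \<le> (\<Sum>j\<in>{0<..P}. ?U j * l) / real P"
    by (intro divide_right_mono sum_mono mult_left_mono sum_fejer_mix_fractions_le Q l) auto
  also have "\<dots> = l * (\<Sum>n\<in>I. (u n)\<^sup>2)"
    by (simp only: sum_distrib_right[symmetric] sum_norm_exponential_sum_sq[OF B P'])
      (use P0 in simp)
  finally show ?thesis .
qed

section \<open>Integrated short sums\<close>

definition window :: "real \<Rightarrow> int \<Rightarrow> real set" where
  "window V n = {of_int n - V..of_int n + V}"

lemma has_integral_indicator_Icc:
  "has_bochner_integral lborel (indicator {a..b :: real}) (max 0 (b - a))"
proof -
  have "has_bochner_integral lborel (indicator {a..b}) (measure lborel {a..b})"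
    by (intro has_bochner_integral_real_indicator) (auto simp: emeasure_lborel_Icc_eq)
  also have "measure lborel {a..b} = max 0 (b - a)" by (cases "a \<le> b") auto
  finally show ?thesis .
qed

lemma has_integral_window: "0 < V \<Longrightarrow> has_bochner_integral lborel (indicator (window V n)) (2 * V)"
  using has_integral_indicator_Icc[of "of_int n - V" "of_int n + V"] by (simp add: window_def)

text \<open>Two windows meet in an interval of length \<open>2 * V - \<bar>m - n\<bar>\<close>, if
  this is non-negative: the tent of the large sieve with \<open>l = 2 * V\<close>. General
  \<open>c\<close> covers both the plain and the cosine-twisted form.\<close>

lemma has_integral_window_form:
  "has_bochner_integral lborel
    (\<lambda>t. \<Sum>m\<in>I. \<Sum>n\<in>I. c m n * (indicator (window V m) t * indicator (window V n) t))
    (\<Sum>m\<in>I. \<Sum>n\<in>I. c m n * max 0 (2 * V - \<bar>of_int m - of_int n\<bar>))"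
proof (intro has_bochner_integral_sum has_bochner_integral_mult_right)
  fix m n :: int
  have "window V m \<inter> window V n = {max (of_int m) (of_int n) - V..min (of_int m) (of_int n) + V}"
    by (auto simp: window_def)
  then have "(\<lambda>t. indicator (window V m) t * indicator (window V n) t :: real)
      = indicator {max (of_int m) (of_int n) - V..min (of_int m) (of_int n) + V}"
    by (simp add: fun_eq_iff flip: indicator_inter_arith)
  moreover have "min (of_int m) (of_int n) + V - (max (of_int m) (of_int n) - V)
      = 2 * V - \<bar>of_int m - of_int n\<bar>" by (simp add: min_def max_def)
  ultimately show "has_bochner_integral lborel
      (\<lambda>t. indicator (window V m) t * indicator (window V n) t) (max 0 (2 * V - \<bar>of_int m - of_int n\<bar>))"
    using has_integral_indicator_Icc[of "max (of_int m) (of_int n) - V" "min (of_int m) (of_int n) + V"]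
    by simp
qed

lemma window_sum_sq:
  "(\<Sum>n\<in>I. u n * indicator (window V n) t)\<^sup>2
    = (\<Sum>m\<in>I. \<Sum>n\<in>I. u m * u n * (indicator (window V m) t * indicator (window V n) t :: real))"
  by (simp add: power2_eq_square sum_product mult_ac)

text \<open>For fixed \<open>t\<close>, \<open>g_fun_sum_le\<close> applies to \<open>u\<close> cut
  off to the window, because the cutoff only shrinks the support. Integration over \<open>t\<close>
  produces the tent coefficients on both sides.\<close>

lemma (in johnsen_gallagher_family) g_fun_window_form_le:
  assumes q: "q \<in> moduli Q"
    and supp: "\<And>n d. n \<in> I \<Longrightarrow> u n \<noteq> 0 \<Longrightarrow> d dvd q \<Longrightarrow> n mod int d \<in> K d"
  shows "g_fun K q * (\<Sum>m\<in>I. \<Sum>n\<in>I. u m * u n * max 0 (2 * V - \<bar>of_int m - of_int n\<bar>))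
    \<le> (\<Sum>a\<in>totatives q. \<Sum>m\<in>I. \<Sum>n\<in>I. u m * u n * max 0 (2 * V - \<bar>of_int m - of_int n\<bar>)
          * cos (2 * pi * ((of_int m - of_int n) * (real a / real q))))"
proof -
  let ?i = "\<lambda>n t. indicator (window V n) t :: real"
  let ?cos = "\<lambda>a m n. cos (2 * pi * ((of_int m - of_int n) * (real a / real q)))"
  have "g_fun K q * (\<Sum>m\<in>I. \<Sum>n\<in>I. u m * u n * (?i m t * ?i n t))
      \<le> (\<Sum>a\<in>totatives q. \<Sum>m\<in>I. \<Sum>n\<in>I. u m * u n * ?cos a m n * (?i m t * ?i n t))" for t
  proof -
    have "(cmod (\<Sum>n\<in>I. of_real (u n * ?i n t) * ee (of_int n * (real a / real q))))\<^sup>2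
        = (\<Sum>m\<in>I. \<Sum>n\<in>I. u m * u n * ?cos a m n * (?i m t * ?i n t))" for a
    proof -
      have "(cmod (\<Sum>n\<in>I. of_real (u n * ?i n t) * ee (of_int n * (real a / real q))))\<^sup>2
        = Re (\<Sum>m\<in>I. \<Sum>n\<in>I. of_real (u m * ?i m t * (u n * ?i n t))
            * ee (of_int m * (real a / real q) - of_int n * (real a / real q)))"
        unfolding cmod_sum_sq[symmetric] by (rule Re_complex_of_real[symmetric])
      also have "\<dots> = (\<Sum>m\<in>I. \<Sum>n\<in>I. u m * ?i m t * (u n * ?i n t) * ?cos a m n)"
        by (simp only: Re_sum times_complex.sel Re_complex_of_real Im_complex_of_real mult_zero_left
            diff_zero ee_def cis.sel left_diff_distrib)
      finally show ?thesis by (simp only: mult_ac)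
    qed
    then show ?thesis
      using g_fun_sum_le[OF q, of I "\<lambda>n. u n * ?i n t"] supp by (simp only: window_sum_sq) auto
  qed
  moreover have "has_bochner_integral lborel
      (\<lambda>t. g_fun K q * (\<Sum>m\<in>I. \<Sum>n\<in>I. u m * u n * (?i m t * ?i n t)))
      (g_fun K q * (\<Sum>m\<in>I. \<Sum>n\<in>I. u m * u n * max 0 (2 * V - \<bar>of_int m - of_int n\<bar>)))"
    by (intro has_bochner_integral_mult_right has_integral_window_form)
  moreover have "has_bochner_integral lborel
      (\<lambda>t. \<Sum>a\<in>totatives q. \<Sum>m\<in>I. \<Sum>n\<in>I. u m * u n * ?cos a m n * (?i m t * ?i n t))
      (\<Sum>a\<in>totatives q. \<Sum>m\<in>I. \<Sum>n\<in>I. u m * u n * ?cos a m n * max 0 (2 * V - \<bar>of_int m - of_int n\<bar>))"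
    by (intro has_bochner_integral_sum has_integral_window_form)
  ultimately have "g_fun K q * (\<Sum>m\<in>I. \<Sum>n\<in>I. u m * u n * max 0 (2 * V - \<bar>of_int m - of_int n\<bar>))
    \<le> (\<Sum>a\<in>totatives q. \<Sum>m\<in>I. \<Sum>n\<in>I. u m * u n * ?cos a m n * max 0 (2 * V - \<bar>of_int m - of_int n\<bar>))"
    by (simp only: has_bochner_integral_iff) (metis (mono_tags, lifting) integral_mono)
  then show ?thesis by (simp only: mult_ac)
qed

lemma (in johnsen_gallagher_family) L_star_window_form_le:
  assumes Q: "1 \<le> Q" and V: "0 < V" and I: "finite I"
    and supp: "\<And>n q. n \<in> I \<Longrightarrow> u n \<noteq> 0 \<Longrightarrow> q \<in> moduli Q \<Longrightarrow> n mod int q \<in> K q"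
  shows "L_star K Q V * (\<Sum>m\<in>I. \<Sum>n\<in>I. u m * u n * max 0 (2 * V - \<bar>of_int m - of_int n\<bar>))
    \<le> 2 * V * (\<Sum>n\<in>I. (u n)\<^sup>2)"
proof -
  let ?E = "\<Sum>m\<in>I. \<Sum>n\<in>I. u m * u n * max 0 (2 * V - \<bar>of_int m - of_int n\<bar>)"
  let ?F = "\<lambda>q a. \<Sum>m\<in>I. \<Sum>n\<in>I. u m * u n * max 0 (2 * V - \<bar>of_int m - of_int n\<bar>)
          * cos (2 * pi * ((of_int m - of_int n) * (real a / real q)))"
  have "L_star K Q V * ?E = (\<Sum>q\<in>moduli Q. g_fun K q * ?E / (2 * V + real q * (real q + Q)))"
    by (simp only: L_star_def sum_distrib_right times_divide_eq_left)
  also have "\<dots> \<le> (\<Sum>q\<in>moduli Q. (\<Sum>a\<in>totatives q. ?F q a) / (2 * V + real q * (real q + Q)))"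
    using Q V supp
    by (intro sum_mono divide_right_mono g_fun_window_form_le) (auto intro: moduli_dvd)
  also have "\<dots> = (\<Sum>q\<in>moduli Q. \<Sum>a\<in>totatives q. ?F q a / (2 * V + real q * (real q + Q)))"
    by (simp only: sum_divide_distrib)
  also have "\<dots> \<le> 2 * V * (\<Sum>n\<in>I. (u n)\<^sup>2)"
    using weighted_large_sieve[OF Q _ I, of "2 * V" u] V by simp
  finally show ?thesis .
qed

text \<open>The term at 1 is positive, its \<open>g_fun\<close> being an empty product, and no term
  is negative. This permits the final division by \<open>L_star\<close>.\<close>

lemma (in johnsen_gallagher_family) L_star_pos:
  assumes "1 \<le> Q" "0 < V"
  shows "0 < L_star K Q V"
proof -
  have 1: "Suc 0 \<in> moduli Q" using assms by (simp add: moduli_def)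
  show ?thesis unfolding L_star_def
  proof (rule sum_pos2[OF finite_moduli 1])
    show "0 < g_fun K (Suc 0) / (2 * V + real (Suc 0) * (real (Suc 0) + Q))"
      using assms by (simp add: g_fun_def)
    fix q assume "q \<in> moduli Q"
    then show "0 \<le> g_fun K q / (2 * V + real q * (real q + Q))"
      using assms g_fun_nonneg[of q] by (intro divide_nonneg_nonneg) auto
  qed
qed

lemma window_form_ge:
  assumes V: "0 < V" and N: "0 \<le> N" and I: "I \<subseteq> index_range M N"
  shows "(2 * V * (\<Sum>n\<in>I. u n))\<^sup>2 / (N + 2 * V)
    \<le> (\<Sum>m\<in>I. \<Sum>n\<in>I. u m * u n * max 0 (2 * V - \<bar>of_int m - of_int n\<bar>))"
proof -
  let ?J = "{M - V..M + N + V}"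
  let ?T = "\<lambda>t. \<Sum>n\<in>I. u n * indicator (window V n) t :: real"
  let ?E = "\<Sum>m\<in>I. \<Sum>n\<in>I. u m * u n * max 0 (2 * V - \<bar>of_int m - of_int n\<bar>)"
  define s where "s = (\<Sum>n\<in>I. u n * (2 * V))"
  \<comment> \<open>\<open>c\<close> is the mean of \<open>?T\<close> over \<open>?J\<close>, the
    constant that minimises the integrated square; non-negativity of that integral is the
    Cauchy-Schwarz inequality.\<close>
  define c where "c = s / (N + 2 * V)"
  have T: "has_bochner_integral lborel ?T s"
    unfolding s_def using V
    by (intro has_bochner_integral_sum has_bochner_integral_mult_right has_integral_window)
  have T2: "has_bochner_integral lborel (\<lambda>t. (?T t)\<^sup>2) ?E"
    unfolding window_sum_sq by (rule has_integral_window_form)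
  have J: "has_bochner_integral lborel (indicator ?J) (N + 2 * V)"
    using has_integral_indicator_Icc[of "M - V" "M + N + V"] N V by (simp add: algebra_simps)
  have "(?T t - c * indicator ?J t)\<^sup>2 = (?T t)\<^sup>2 - 2 * c * ?T t + c\<^sup>2 * indicator ?J t" for t
  proof -
    \<comment> \<open>The range of \<open>n\<close> places every window inside \<open>?J\<close>, so
      \<open>?T\<close> vanishes outside it.\<close>
    have "indicator (window V n) t * indicator ?J t = (indicator (window V n) t :: real)" if "n \<in> I" for n
      using subsetD[OF I that] by (auto simp: window_def index_range_def indicator_def)
    then have "?T t * indicator ?J t = ?T t"
      unfolding sum_distrib_right by (intro sum.cong refl) (simp only: mult.assoc)
    moreover have "(indicator ?J t)\<^sup>2 = (indicator ?J t :: real)" by (simp add: indicator_def)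
    ultimately show ?thesis by (simp add: power2_diff power_mult_distrib mult_ac)
  qed
  then have "has_bochner_integral lborel (\<lambda>t. (?T t - c * indicator ?J t)\<^sup>2)
      (?E - 2 * c * s + c\<^sup>2 * (N + 2 * V))"
    using T T2 J by (simp only:)
      (intro has_bochner_integral_add has_bochner_integral_diff has_bochner_integral_mult_right)
  note has_bochner_integral_integral_eq[OF this, symmetric]
  then have "0 \<le> ?E - 2 * c * s + c\<^sup>2 * (N + 2 * V)"
    by (simp only:) (rule Bochner_Integration.integral_nonneg, simp)
  also have "\<dots> = ?E - s\<^sup>2 / (N + 2 * V)"
    using N V by (simp add: c_def power2_eq_square)
  moreover have "s = 2 * V * (\<Sum>n\<in>I. u n)"
    unfolding s_def sum_distrib_right[symmetric] by (rule mult.commute)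
  ultimately show ?thesis by simp
qed

theorem theorem2p1:
  fixes M N Q V :: real and u :: "int \<Rightarrow> real" and K :: "nat \<Rightarrow> int set"
  assumes "N \<ge> 1" and "Q \<ge> 1"
    and "residue_sets Q K" and "multiplicative_sets Q K"
    and "consistent_sets Q K" and "johnsen_gallagher Q K"
    and "\<forall>n\<in>index_range M N. u n \<ge> 0"
    and "supported_on M N u Q K"
    and "0 < V" and "V \<le> N / 2"
  shows "(1 - 2 * V / N) / N * \<bar>\<Sum>n\<in>index_range M N. u n\<bar>\<^sup>2
           \<le> (LINT t|lborel.
                \<bar>\<Sum>n\<in>{n \<in> index_range M N. \<bar>of_int n - t\<bar> \<le> V}. u n\<bar>\<^sup>2 / (4 * V\<^sup>2))
       \<and> (LINT t|lborel.
                \<bar>\<Sum>n\<in>{n \<in> index_range M N. \<bar>of_int n - t\<bar> \<le> V}. u n\<bar>\<^sup>2 / (4 * V\<^sup>2))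
           \<le> 1 / (2 * V * L_star K Q V) * (\<Sum>n\<in>index_range M N. (u n)\<^sup>2)"
proof -
  interpret johnsen_gallagher_family Q K using assms by unfold_locales
  let ?I = "index_range M N"
  \<comment> \<open>The integral of the squared short sum; both inequalities concern
    \<open>E / (4 * V\<^sup>2)\<close>.\<close>
  define E where "E = (\<Sum>m\<in>?I. \<Sum>n\<in>?I. u m * u n * max 0 (2 * V - \<bar>of_int m - of_int n\<bar>))"
  define S where "S = (\<Sum>n\<in>?I. u n)"
  define U where "U = (\<Sum>n\<in>?I. (u n)\<^sup>2)"
  note V = \<open>0 < V\<close>
  have fin: "finite ?I"
  proof (rule finite_subset)
    show "?I \<subseteq> {\<lfloor>M\<rfloor>..\<lfloor>M + N\<rfloor>}" by (auto simp: index_range_def le_floor_iff floor_le_iff)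
  qed simp
  have "(\<Sum>n\<in>{n \<in> ?I. \<bar>of_int n - t\<bar> \<le> V}. u n) = (\<Sum>n\<in>?I. u n * indicator (window V n) t)" for t
    unfolding sum.inter_filter[OF fin]
    by (intro sum.cong refl) (auto simp: window_def indicator_def abs_le_iff)
  then have lint: "(LINT t|lborel. \<bar>\<Sum>n\<in>{n \<in> ?I. \<bar>of_int n - t\<bar> \<le> V}. u n\<bar>\<^sup>2 / (4 * V\<^sup>2)) = E / (4 * V\<^sup>2)"
    using has_bochner_integral_integral_eq[OF has_integral_window_form[of "\<lambda>m n. u m * u n" V ?I]]
    by (simp add: E_def window_sum_sq)
  have lower: "(1 - 2 * V / N) / N * \<bar>S\<bar>\<^sup>2 \<le> E / (4 * V\<^sup>2)"
  proof -
    \<comment> \<open>Cauchy-Schwarz gives the stronger constant \<open>1 / (N + 2 * V)\<close>; the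
      comparison is \<open>(N - 2 * V) * (N + 2 * V) \<le> N * N\<close>.\<close>
    have "(1 - 2 * V / N) / N \<le> 1 / (N + 2 * V)"
    proof -
      have "(N - 2 * V) * (N + 2 * V) \<le> N * N" by (simp add: algebra_simps)
      then show ?thesis using assms(1) V by (simp add: field_simps)
    qed
    then have "(1 - 2 * V / N) / N * \<bar>S\<bar>\<^sup>2 \<le> 1 / (N + 2 * V) * \<bar>S\<bar>\<^sup>2" by (rule mult_right_mono) simp
    also have "\<dots> = (2 * V * S)\<^sup>2 / (N + 2 * V) / (4 * V\<^sup>2)"
      using V assms(1) by (simp add: power_mult_distrib)
    also have "\<dots> \<le> E / (4 * V\<^sup>2)"
      unfolding E_def S_def using V assms(1) by (intro divide_right_mono window_form_ge) auto
    finally show ?thesis .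
  qed
  have upper: "E / (4 * V\<^sup>2) \<le> 1 / (2 * V * L_star K Q V) * U"
  proof -
    have L: "0 < L_star K Q V" using L_star_pos assms(2) V by blast
    have "L_star K Q V * E \<le> 2 * V * U"
      unfolding E_def U_def using assms(2,8) V fin
      by (intro L_star_window_form_le) (auto simp: supported_on_def)
    then show ?thesis using L V by (simp add: field_simps power2_eq_square)
  qed
  show ?thesis unfolding lint using lower upper unfolding S_def U_def by (rule conjI)
qed

end
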